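(* Let $(P_{\mathcal X},\mathcal D_{\mathcal X})$ be a $2$-integrable $C^k$-diffeological statistical model on a measurable space $\mathcal X$, with $k\in\{1,2,\dots\}\cup\{\infty\}$, and let $\rho_{\mathfrak g}:P_{\mathcal X}\times P_{\mathcal X}\to[0,\infty]$ be its diffeological Fisher distance. Then $\rho_{\mathfrak g}$ is an extended metric on $P_{\mathcal X}$, i.e. it satisfies all the axioms of a metric (non-negativity, symmetry, triangle inequality, and $\rho_{\mathfrak g}(x,y)=0$ if and only if $x=y$), except that it is allowed to take the value $+\infty$.
   Context: Let $\mathcal X$ be a measurable space, $\mathcal S(\mathcal X)$ the Banach space of finite signed measures on $\mathcal X$ with the total variation norm $\|\cdot\|_{TV}$ (so $\|\mu\|_{TV}=|\mu|(\mathcal X)$), and $\mathcal P(\mathcal X)\subset\mathcal S(\mathcal X)$ the set of probability measures. A statistical model is a subset $P_{\mathcal X}\subset\mathcal P(\mathcal X)$; $i:P_{\mathcal X}\to\mathcal S(\mathcal X)$ is the inclusion, and $P_{\mathcal X}$ carries the topology induced by $\|\cdot\|_{TV}$. A $C^k$-diffeology on a nonempty set $X$ is a set $\mathcal D$ of mappings $\mathbf p:U\to X$, $U$ open in $\mathbb R^n$, $n$ running over the nonnegative integers, such that: (D1) all constant mappings $\mathbb R^n\to X$ belong to $\mathcal D$; (D2) if $\mathbf p:U\to X$ is such that every $r\in U$ has an open neighbourhood $V$ with $\mathbf p|_V\in\mathcal D$, then $\mathbf p\in\mathcal D$; (D3) for every $\mathbf p:U\to X$ in $\mathcal D$, every open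 $V$ in a real coordinate space and every $\psi\in C^k(V,U)$, $\mathbf p\circ\psi\in\mathcal D$. Elements $\mathbf p:U\to X$ of $\mathcal D$ are called $C^k$-maps from $U$ to $X$. A $C^k$-diffeological statistical model $(P_{\mathcal X},\mathcal D_{\mathcal X})$ is a statistical model with a $C^k$-diffeology $\mathcal D_{\mathcal X}$ such that for every $\mathbf p\in\mathcal D_{\mathcal X}$ the map $i\circ\mathbf p$ is a (Fréchet) $C^k$-map into the Banach space $\mathcal S(\mathcal X)$. For a $C^k$-map $c:(-\varepsilon,\varepsilon)\to(P_{\mathcal X},\mathcal D_{\mathcal X})$ the tangent vector of $c$ at $c(0)$ is the derivative $\partial_tc(0)\in\mathcal S(\mathcal X)$ of $i\circ c$ at $0$; the tangent cone $C_\xi(P_{\mathcal X},\mathcal D_{\mathcal X})$ is the set of all such vectors with $c(0)=\xi$. Every $v\in C_\xi(P_{\mathcal X},\mathcal D_{\mathcal X})$ is absolutely continuous with respect to $\xi$, and one sets $\log v:=dv/d\xi\in L^1(\mathcal X,\xi)$. The model is almost $2$-integrable if $\log v\in L^2(\mathcal X,\xi)$ for all $\xi\in P_{\mathcal X}$ and $v\in C_\xi(P_{\mathcal X},\mathcal D_{\mathcal X})$. Then the diffeological Fisher metric is $\mathfrak g_\xi(v,w)=\int_{\mathcal X}\log v\cdot\log w\,d\xi$, and $|v|_{\mathfrak g}=\mathfrak g_\xi(v,v)^{1/2}$. It is $2$-integrable if, moreover, for every $\mathbf p:U\to P_{\mathcal X}$ in $\mathcal D_{\mathcal X}$ the function $v\mapsto|d\mathbf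 p(v)|_{\mathfrak g}$ is continuous on $TU$. A map $c:[a,b]\to P_{\mathcal X}$ is a $C^k$-curve if it is the restriction of a $C^k$-map $(a-\varepsilon,b+\varepsilon)\to(P_{\mathcal X},\mathcal D_{\mathcal X})$ for some $\varepsilon>0$; its length is $L(c)=\int_a^b|\dot c(t)|_{\mathfrak g}\,dt$. A continuous map $c:[0,1]\to P_{\mathcal X}$ is a piece-wise $C^k$-curve if there are $0=a_0<a_1<\dots<a_m=1$ such that each $c|_{[a_{j-1},a_j]}$ is a $C^k$-curve; its length is the sum of the lengths of these pieces. The diffeological Fisher distance $\rho_{\mathfrak g}(x,y)$ is the infimum of the lengths of piece-wise $C^k$-curves $c$ with $c(0)=x$, $c(1)=y$ (and $\rho_{\mathfrak g}(x,y)=\infty$ if there is no such curve). *)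

theory Defs
  imports "HOL-Probability.Probability"
begin

section \<open>The space of finite signed measures with the total variation norm\<close>

text \<open>
  The \<open>\<sigma>\<close>-algebra is a term, so \<open>\<S>(\<X>)\<close> cannot be a type of its own. It is a linear subspace
  \<open>signed_measures M\<close> of the type of all real set functions of bounded variation. The norm of this type
  is the total variation \<open>|\<mu>|(\<X>)\<close>, the supremum of \<open>\<Sum>|\<mu> A|\<close> over finite families of disjoint
  sets; the sets of such a family may be taken measurable, because a signed measure on \<open>M\<close> is
  normalised, as measures in the library are, to be \<open>0\<close> outside \<open>sets M\<close>
  (\<open>norm_signed_measure\<close> below).
\<close>

abbreviation disjoint_families :: "'a set set set" where
  "disjoint_families \<equiv> {\<A>. finite \<A> \<and> disjoint \<A>}"

definition bounded_variation :: "('a set \<Rightarrow> real) \<Rightarrow> bool" where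
  "bounded_variation f \<longleftrightarrow> bdd_above ((\<lambda>\<A>. \<Sum>A\<in>\<A>. \<bar>f A\<bar>) ` disjoint_families)"

lemma bounded_variationI:
  assumes "\<And>\<A>. finite \<A> \<Longrightarrow> disjoint \<A> \<Longrightarrow> (\<Sum>A\<in>\<A>. \<bar>f A\<bar>) \<le> B"
  shows "bounded_variation f"
  unfolding bounded_variation_def using assms by (intro bdd_aboveI2[where M = B]) auto

lemma bounded_variation_sum_le:
  assumes "bounded_variation f" "finite \<A>" "disjoint \<A>"
  shows "(\<Sum>A\<in>\<A>. \<bar>f A\<bar>) \<le> (SUP \<A>\<in>disjoint_families. \<Sum>A\<in>\<A>. \<bar>f A\<bar>)"
  using assms unfolding bounded_variation_def by (intro cSUP_upper) auto

lemma disjoint_families_nonempty: "disjoint_families \<noteq> {}"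
proof -
  have "{} \<in> disjoint_families" by simp
  then show ?thesis by blast
qed

typedef 'a bv_set_fun = "{f :: 'a set \<Rightarrow> real. bounded_variation f}"
  morphisms set_fun Abs_bv_set_fun
  by (rule exI[of _ "\<lambda>_. 0"]) (auto intro: bounded_variationI[where B = 0])

setup_lifting type_definition_bv_set_fun

instantiation bv_set_fun :: (type) real_vector
begin

lift_definition zero_bv_set_fun :: "'a bv_set_fun" is "\<lambda>_. 0"
  by (rule bounded_variationI[where B = 0]) auto

lift_definition plus_bv_set_fun :: "'a bv_set_fun \<Rightarrow> 'a bv_set_fun \<Rightarrow> 'a bv_set_fun"
  is "\<lambda>f g A. f A + g A"
  subgoal for f g
  proof (rule bounded_variationI)
    fix \<A> :: "'a set set" assume bv: "bounded_variation f" "bounded_variation g"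
      and \<A>: "finite \<A>" "disjoint \<A>"
    have "(\<Sum>A\<in>\<A>. \<bar>f A + g A\<bar>) \<le> (\<Sum>A\<in>\<A>. \<bar>f A\<bar>) + (\<Sum>A\<in>\<A>. \<bar>g A\<bar>)"
      unfolding sum.distrib[symmetric] by (intro sum_mono abs_triangle_ineq)
    also have "\<dots> \<le> (SUP \<A>\<in>disjoint_families. \<Sum>A\<in>\<A>. \<bar>f A\<bar>)
                + (SUP \<A>\<in>disjoint_families. \<Sum>A\<in>\<A>. \<bar>g A\<bar>)"
      using bv \<A> by (intro add_mono bounded_variation_sum_le)
    finally show "(\<Sum>A\<in>\<A>. \<bar>f A + g A\<bar>) \<le> (SUP \<A>\<in>disjoint_families. \<Sum>A\<in>\<A>. \<bar>f A\<bar>)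
                + (SUP \<A>\<in>disjoint_families. \<Sum>A\<in>\<A>. \<bar>g A\<bar>)" .
  qed
  done

lift_definition scaleR_bv_set_fun :: "real \<Rightarrow> 'a bv_set_fun \<Rightarrow> 'a bv_set_fun"
  is "\<lambda>c f A. c * f A"
  subgoal for c f
  proof (rule bounded_variationI)
    fix \<A> :: "'a set set" assume "bounded_variation f" "finite \<A>" "disjoint \<A>"
    then show "(\<Sum>A\<in>\<A>. \<bar>c * f A\<bar>) \<le> \<bar>c\<bar> * (SUP \<A>\<in>disjoint_families. \<Sum>A\<in>\<A>. \<bar>f A\<bar>)"
      unfolding abs_mult sum_distrib_left[symmetric]
      by (intro mult_left_mono bounded_variation_sum_le) auto
  qed
  done

lift_definition uminus_bv_set_fun :: "'a bv_set_fun \<Rightarrow> 'a bv_set_fun" is "\<lambda>f A. - f A"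
  by (simp add: bounded_variation_def)

definition minus_bv_set_fun :: "'a bv_set_fun \<Rightarrow> 'a bv_set_fun \<Rightarrow> 'a bv_set_fun" where
  "minus_bv_set_fun f g = f + (- g)"

instance
proof
  fix f g h :: "'a bv_set_fun" and a b :: real
  show "f + g + h = f + (g + h)" by transfer (simp add: fun_eq_iff)
  show "f + g = g + f" by transfer (simp add: fun_eq_iff)
  show "0 + f = f" by transfer simp
  show "- f + f = 0" by transfer (simp add: fun_eq_iff)
  show "f - g = f + - g" by (fact minus_bv_set_fun_def)
  show "a *\<^sub>R (f + g) = a *\<^sub>R f + a *\<^sub>R g"
    by transfer (simp add: fun_eq_iff algebra_simps)
  show "(a + b) *\<^sub>R f = a *\<^sub>R f + b *\<^sub>R f"
    by transfer (simp add: fun_eq_iff algebra_simps)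
  show "a *\<^sub>R b *\<^sub>R f = (a * b) *\<^sub>R f" by transfer (simp add: fun_eq_iff)
  show "1 *\<^sub>R f = f" by transfer simp
qed

end

instantiation bv_set_fun :: (type) real_normed_vector
begin

lift_definition norm_bv_set_fun :: "'a bv_set_fun \<Rightarrow> real"
  is "\<lambda>f. SUP \<A>\<in>disjoint_families. \<Sum>A\<in>\<A>. \<bar>f A\<bar>" .

definition dist_bv_set_fun :: "'a bv_set_fun \<Rightarrow> 'a bv_set_fun \<Rightarrow> real" where
  "dist_bv_set_fun f g = norm (f - g)"

definition sgn_bv_set_fun :: "'a bv_set_fun \<Rightarrow> 'a bv_set_fun" where
  "sgn_bv_set_fun f = f /\<^sub>R norm f"

definition uniformity_bv_set_fun :: "('a bv_set_fun \<times> 'a bv_set_fun) filter" where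
  "uniformity_bv_set_fun = (INF e\<in>{0<..}. principal {(x, y). dist x y < e})"

definition open_bv_set_fun :: "'a bv_set_fun set \<Rightarrow> bool" where
  "open_bv_set_fun U = (\<forall>x\<in>U. eventually (\<lambda>(x', y). x' = x \<longrightarrow> y \<in> U) uniformity)"

instance
proof
  fix f g :: "'a bv_set_fun" and a :: real
  show "dist f g = norm (f - g)" by (fact dist_bv_set_fun_def)
  show "sgn f = f /\<^sub>R norm f" by (fact sgn_bv_set_fun_def)
  show "(uniformity :: ('a bv_set_fun \<times> 'a bv_set_fun) filter)
      = (INF e\<in>{0<..}. principal {(x, y). dist x y < e})"
    by (fact uniformity_bv_set_fun_def)
  show "open U = (\<forall>x\<in>U. \<forall>\<^sub>F (x', y) in uniformity. x' = x \<longrightarrow> y \<in> U)" for U :: "'a bv_set_fun set"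
    by (fact open_bv_set_fun_def)
  show "(norm f = 0) = (f = 0)"
  proof transfer
    fix f :: "'a set \<Rightarrow> real" assume bv: "bounded_variation f"
    show "((SUP \<A>\<in>disjoint_families. \<Sum>A\<in>\<A>. \<bar>f A\<bar>) = 0) = (f = (\<lambda>_. 0))"
    proof
      assume 0: "(SUP \<A>\<in>disjoint_families. \<Sum>A\<in>\<A>. \<bar>f A\<bar>) = 0"
      have "\<bar>f A\<bar> \<le> 0" for A
        using bounded_variation_sum_le[OF bv, of "{A}"] 0 by (simp add: disjoint_def)
      then show "f = (\<lambda>_. 0)" by auto
    next
      assume "f = (\<lambda>_. 0)"
      then show "(SUP \<A>\<in>disjoint_families. \<Sum>A\<in>\<A>. \<bar>f A\<bar>) = 0"
        by (simp only: abs_zero sum.neutral_const cSUP_const[OF disjoint_families_nonempty])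
    qed
  qed
  show "norm (f + g) \<le> norm f + norm g"
  proof transfer
    fix f g :: "'a set \<Rightarrow> real" assume bv: "bounded_variation f" "bounded_variation g"
    show "(SUP \<A>\<in>disjoint_families. \<Sum>A\<in>\<A>. \<bar>f A + g A\<bar>)
        \<le> (SUP \<A>\<in>disjoint_families. \<Sum>A\<in>\<A>. \<bar>f A\<bar>) + (SUP \<A>\<in>disjoint_families. \<Sum>A\<in>\<A>. \<bar>g A\<bar>)"
    proof (rule cSUP_least[OF disjoint_families_nonempty])
      fix \<A> :: "'a set set" assume "\<A> \<in> disjoint_families"
      then have \<A>: "finite \<A>" "disjoint \<A>" by auto
      have "(\<Sum>A\<in>\<A>. \<bar>f A + g A\<bar>) \<le> (\<Sum>A\<in>\<A>. \<bar>f A\<bar>) + (\<Sum>A\<in>\<A>. \<bar>g A\<bar>)"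
        unfolding sum.distrib[symmetric] by (intro sum_mono abs_triangle_ineq)
      then show "(\<Sum>A\<in>\<A>. \<bar>f A + g A\<bar>) \<le> (SUP \<A>\<in>disjoint_families. \<Sum>A\<in>\<A>. \<bar>f A\<bar>)
          + (SUP \<A>\<in>disjoint_families. \<Sum>A\<in>\<A>. \<bar>g A\<bar>)"
        using bounded_variation_sum_le[OF bv(1) \<A>] bounded_variation_sum_le[OF bv(2) \<A>] by linarith
    qed
  qed
  show "norm (a *\<^sub>R f) = \<bar>a\<bar> * norm f"
  proof transfer
    fix a :: real and f :: "'a set \<Rightarrow> real" assume bv: "bounded_variation f"
    let ?N = "\<lambda>f :: 'a set \<Rightarrow> real. SUP \<A>\<in>disjoint_families. \<Sum>A\<in>\<A>. \<bar>f A\<bar>"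
    have le: "?N (\<lambda>A. a * f A) \<le> \<bar>a\<bar> * ?N f" if "bounded_variation f" for a f
    proof (rule cSUP_least[OF disjoint_families_nonempty])
      fix \<A> :: "'a set set" assume "\<A> \<in> disjoint_families"
      then show "(\<Sum>A\<in>\<A>. \<bar>a * f A\<bar>) \<le> \<bar>a\<bar> * ?N f"
        unfolding abs_mult sum_distrib_left[symmetric]
        using that by (intro mult_left_mono bounded_variation_sum_le) auto
    qed
    have bva: "bounded_variation (\<lambda>A. a * f A)"
      using set_fun[of "a *\<^sub>R Abs_bv_set_fun f"] bv
      by (simp add: scaleR_bv_set_fun.rep_eq Abs_bv_set_fun_inverse)
    show "?N (\<lambda>A. a * f A) = \<bar>a\<bar> * ?N f"
    proof (cases "a = 0")
      case True
      then show ?thesis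
        by (simp only: abs_zero mult_zero_left sum.neutral_const
            cSUP_const[OF disjoint_families_nonempty])
    next
      case False
      have "?N f \<le> \<bar>inverse a\<bar> * ?N (\<lambda>A. a * f A)"
        using le[OF bva, of "inverse a"] False by (simp add: mult.assoc[symmetric])
      then have "\<bar>a\<bar> * ?N f \<le> ?N (\<lambda>A. a * f A)"
        using False by (simp add: field_simps)
      with le[OF bv, of a] show ?thesis by simp
    qed
  qed
qed

end

definition countably_additive_on :: "'a measure \<Rightarrow> ('a set \<Rightarrow> real) \<Rightarrow> bool" where
  "countably_additive_on M f \<longleftrightarrow>
    (\<forall>A :: nat \<Rightarrow> 'a set. range A \<subseteq> sets M \<longrightarrow> disjoint_family A \<longrightarrow> (\<lambda>i. f (A i)) sums f (\<Union>i. A i))"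

definition signed_measures :: "'a measure \<Rightarrow> 'a bv_set_fun set" where
  "signed_measures M =
    {\<mu>. (\<forall>A. A \<notin> sets M \<longrightarrow> set_fun \<mu> A = 0) \<and> countably_additive_on M (set_fun \<mu>)}"

text \<open>
  Every countably additive real function on \<open>sets M\<close> has bounded variation, so the type contains
  all finite signed measures.
\<close>

lemma countably_additive_on_bounded_variation:
  assumes f: "countably_additive_on M f" and out: "\<And>A. A \<notin> sets M \<Longrightarrow> f A = 0"
  shows "bounded_variation f"
proof (rule ccontr)
  assume not_bv: "\<not> bounded_variation f"
  define S where "S E B \<longleftrightarrow>
    (\<exists>\<A>. finite \<A> \<and> disjoint \<A> \<and> \<A> \<subseteq> sets M \<and> \<Union>\<A> \<subseteq> E \<and> (\<Sum>A\<in>\<A>. \<bar>f A\<bar>) > B)" for E B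
  have f_empty: "f {} = 0"
  proof -
    have "(\<lambda>i::nat. f {}) sums f (\<Union>i::nat. {})"
      using f[unfolded countably_additive_on_def, rule_format, of "\<lambda>_. {}"]
      by (auto simp: disjoint_family_on_def)
    then show ?thesis using summable_const_iff sums_summable by blast
  qed
  have add: "f (A \<union> B) = f A + f B" if "A \<in> sets M" "B \<in> sets M" "A \<inter> B = {}" for A B
  proof -
    have "range (binaryset A B) \<subseteq> sets M" using that by (simp add: range_binaryset_eq)
    moreover have "disjoint_family (binaryset A B)"
      using that(3) by (auto simp: disjoint_family_on_def binaryset_def)
    ultimately have "(\<lambda>i. f (binaryset A B i)) sums f (\<Union>i. binaryset A B i)"
      using f unfolding countably_additive_on_def by blast
    then show ?thesis
      using binaryset_sums[of f A B, OF f_empty] sums_unique2 by (metis UN_binaryset_eq)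
  qed
  have add_Union: "f (\<Union>\<A>) = (\<Sum>A\<in>\<A>. f A)"
    if "finite \<A>" "disjoint \<A>" "\<A> \<subseteq> sets M" for \<A>
    using that
  proof (induction \<A> rule: finite_induct)
    case (insert A \<A>)
    have "A \<inter> \<Union>\<A> = {}" using insert.hyps insert.prems(1) by (auto simp: disjoint_def)
    then have "f (A \<union> \<Union>\<A>) = f A + f (\<Union>\<A>)"
      using insert by (intro add sets.finite_Union) auto
    moreover have "disjoint \<A>" using insert.prems(1) by (auto simp: disjoint_def)
    ultimately show ?case using insert by simp
  qed (simp add: f_empty)
  have split: "\<exists>E'\<in>sets M. E' \<subseteq> E \<and> \<bar>f (E - E')\<bar> \<ge> 1 \<and> (\<forall>B. S E' B)"
    if E: "E \<in> sets M" and un: "\<forall>B. S E B" for E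
  proof -
    obtain \<A> where \<A>: "finite \<A>" "disjoint \<A>" "\<A> \<subseteq> sets M" "\<Union>\<A> \<subseteq> E"
      and big: "(\<Sum>A\<in>\<A>. \<bar>f A\<bar>) > 2 * (1 + \<bar>f E\<bar>)"
      using un unfolding S_def by meson
    define p where "p = {A\<in>\<A>. f A \<ge> 0}"
    define q where "q = {A\<in>\<A>. \<not> f A \<ge> 0}"
    have pq: "finite p" "disjoint p" "p \<subseteq> sets M" "finite q" "disjoint q" "q \<subseteq> sets M"
      "\<Union>p \<subseteq> E" "\<Union>q \<subseteq> E"
      using \<A> by (auto simp: p_def q_def disjoint_def)
    have "(\<Sum>A\<in>\<A>. \<bar>f A\<bar>) = (\<Sum>A\<in>p. \<bar>f A\<bar>) + (\<Sum>A\<in>q. \<bar>f A\<bar>)"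
      unfolding p_def q_def using \<A>(1)
      by (subst sum.union_disjoint[symmetric]) (auto intro: sum.cong)
    also have "(\<Sum>A\<in>p. \<bar>f A\<bar>) = f (\<Union>p)"
      unfolding add_Union[OF pq(1-3)] by (intro sum.cong) (auto simp: p_def)
    also have "(\<Sum>A\<in>q. \<bar>f A\<bar>) = - f (\<Union>q)"
      unfolding add_Union[OF pq(4-6)] sum_negf[symmetric] by (intro sum.cong) (auto simp: q_def)
    finally have "f (\<Union>p) + - f (\<Union>q) > 2 * (1 + \<bar>f E\<bar>)" using big by simp
    then have "\<bar>f (\<Union>p)\<bar> > 1 + \<bar>f E\<bar> \<or> \<bar>f (\<Union>q)\<bar> > 1 + \<bar>f E\<bar>"
      by (smt (verit))
    then obtain A where A: "A \<in> sets M" "A \<subseteq> E" "\<bar>f A\<bar> > 1 + \<bar>f E\<bar>"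
      using pq by (metis sets.finite_Union)
    have "f E = f A + f (E - A)"
      using add[of A "E - A"] A E by (simp add: Un_absorb1 Un_Diff_cancel)
    then have "\<bar>f (E - A)\<bar> \<ge> 1" "\<bar>f (E - (E - A))\<bar> \<ge> 1"
      using A by (auto simp: double_diff)
    moreover have "(\<forall>B. S A B) \<or> (\<forall>B. S (E - A) B)"
    proof (rule ccontr)
      assume "\<not> ?thesis"
      then obtain B C where BC: "\<not> S A B" "\<not> S (E - A) C" by auto
      obtain \<B> where \<B>: "finite \<B>" "disjoint \<B>" "\<B> \<subseteq> sets M" "\<Union>\<B> \<subseteq> E"
        and big: "(\<Sum>D\<in>\<B>. \<bar>f D\<bar>) > B + C"
        using un unfolding S_def by meson
      have restr: "(\<Sum>D\<in>\<B>. \<bar>f (D \<inter> G)\<bar>) \<le> b" if "G \<in> sets M" "\<not> S G b" for G b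
      proof -
        let ?C = "(\<lambda>D. D \<inter> G) ` \<B>"
        have "finite ?C" "disjoint ?C" "?C \<subseteq> sets M" "\<Union>?C \<subseteq> G"
          using \<B> that(1) by (auto simp: disjoint_def)
        then have "(\<Sum>D\<in>?C. \<bar>f D\<bar>) \<le> b" using that(2) unfolding S_def by (meson not_le)
        moreover have "(\<Sum>D\<in>?C. \<bar>f D\<bar>) = (\<Sum>D\<in>\<B>. \<bar>f (D \<inter> G)\<bar>)"
        proof (rule sum.reindex_nontrivial[OF \<B>(1), unfolded o_def])
          fix x y assume "x \<in> \<B>" "y \<in> \<B>" "x \<noteq> y" "x \<inter> G = y \<inter> G"
          then have "x \<inter> G = {}" using \<B>(2) by (auto simp: disjoint_def)
          then show "\<bar>f (x \<inter> G)\<bar> = 0" by (simp add: f_empty)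
        qed
        ultimately show ?thesis by simp
      qed
      have "f D = f (D \<inter> A) + f (D \<inter> (E - A))" if "D \<in> \<B>" for D
      proof -
        have "D = (D \<inter> A) \<union> (D \<inter> (E - A))" using that \<B>(4) by auto
        then show ?thesis
          using add[of "D \<inter> A" "D \<inter> (E - A)"] that \<B>(3) A E by auto
      qed
      then have "(\<Sum>D\<in>\<B>. \<bar>f D\<bar>) \<le> (\<Sum>D\<in>\<B>. \<bar>f (D \<inter> A)\<bar> + \<bar>f (D \<inter> (E - A))\<bar>)"
        by (intro sum_mono) (metis abs_triangle_ineq)
      also have "\<dots> \<le> B + C"
        unfolding sum.distrib using A E BC by (intro add_mono restr) auto
      finally show False using big by simp
    qed
    ultimately show ?thesis
    proof (elim disjE)
      assume "\<bar>f (E - A)\<bar> \<ge> 1" "\<forall>B. S A B"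
      then show ?thesis using A by (intro bexI[of _ A]) auto
    next
      assume "\<bar>f (E - (E - A))\<bar> \<ge> 1" "\<forall>B. S (E - A) B"
      then show ?thesis using A E by (intro bexI[of _ "E - A"]) auto
    qed
  qed
  have "S (space M) B" for B
  proof -
    obtain \<A> where \<A>: "finite \<A>" "disjoint \<A>" "(\<Sum>A\<in>\<A>. \<bar>f A\<bar>) > B"
      using not_bv bounded_variationI[of f B] by (meson not_le)
    have "(\<Sum>A\<in>\<A>. \<bar>f A\<bar>) = (\<Sum>A\<in>\<A> \<inter> sets M. \<bar>f A\<bar>)"
      using \<A>(1) out by (intro sum.mono_neutral_right) auto
    moreover have "disjoint (\<A> \<inter> sets M)" using \<A>(2) by (auto simp: disjoint_def)
    ultimately show ?thesis
      unfolding S_def using \<A> sets.sets_into_space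
      by (intro exI[of _ "\<A> \<inter> sets M"]) auto
  qed
  then have "\<exists>X. \<forall>n. (X n \<in> sets M \<and> (\<forall>B. S (X n) B)) \<and>
      (X (Suc n) \<subseteq> X n \<and> \<bar>f (X n - X (Suc n))\<bar> \<ge> 1)"
    by (intro dependent_nat_choice[where P = "\<lambda>_ E. E \<in> sets M \<and> (\<forall>B. S E B)"
          and Q = "\<lambda>_ E E'. E' \<subseteq> E \<and> \<bar>f (E - E')\<bar> \<ge> 1"])
      (blast, use split in blast)
  then obtain X where X: "\<And>n. X n \<in> sets M" "\<And>n. X (Suc n) \<subseteq> X n"
      "\<And>n. \<bar>f (X n - X (Suc n))\<bar> \<ge> 1"
    by blast
  have dec: "decseq X" by (rule decseq_SucI) (fact X(2))
  have "disjoint_family (\<lambda>n. X n - X (Suc n))"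
    unfolding disjoint_family_on_def
  proof (intro ballI impI)
    fix m n :: nat assume "m \<noteq> n"
    then have "Suc m \<le> n \<or> Suc n \<le> m" by auto
    then show "(X m - X (Suc m)) \<inter> (X n - X (Suc n)) = {}"
      using decseqD[OF dec] by blast
  qed
  moreover have "range (\<lambda>n. X n - X (Suc n)) \<subseteq> sets M" using X(1) by auto
  ultimately have "(\<lambda>n. f (X n - X (Suc n))) sums f (\<Union>n. X n - X (Suc n))"
    using f[unfolded countably_additive_on_def, rule_format, of "\<lambda>n. X n - X (Suc n)"] by blast
  then have "summable (\<lambda>n. f (X n - X (Suc n)))" by (rule sums_summable)
  then have "(\<lambda>n. f (X n - X (Suc n))) \<longlonglongrightarrow> 0" by (rule summable_LIMSEQ_zero)
  then obtain n where "\<bar>f (X n - X (Suc n))\<bar> < 1"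
    using LIMSEQ_D[of "\<lambda>n. f (X n - X (Suc n))" 0 1] by auto
  with X(3)[of n] show False by simp
qed

lemma norm_signed_measure:
  assumes "\<mu> \<in> signed_measures M"
  shows "norm \<mu> = (SUP \<A>\<in>{\<A>. finite \<A> \<and> disjoint \<A> \<and> \<A> \<subseteq> sets M}. \<Sum>A\<in>\<A>. \<bar>set_fun \<mu> A\<bar>)"
proof -
  let ?s = "\<lambda>\<A>. \<Sum>A\<in>\<A>. \<bar>set_fun \<mu> A\<bar>"
  have "?s ` disjoint_families = ?s ` {\<A>. finite \<A> \<and> disjoint \<A> \<and> \<A> \<subseteq> sets M}"
  proof (intro subset_antisym subsetI)
    fix s assume "s \<in> ?s ` disjoint_families"
    then obtain \<A> where \<A>: "finite \<A>" "disjoint \<A>" "s = ?s \<A>" by auto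
    have "?s \<A> = ?s (\<A> \<inter> sets M)"
      using \<A> assms by (intro sum.mono_neutral_right) (auto simp: signed_measures_def)
    moreover have "disjoint (\<A> \<inter> sets M)" using \<A>(2) by (auto simp: disjoint_def)
    ultimately show "s \<in> ?s ` {\<A>. finite \<A> \<and> disjoint \<A> \<and> \<A> \<subseteq> sets M}"
      using \<A> by (intro image_eqI[of _ _ "\<A> \<inter> sets M"]) auto
  qed auto
  then show ?thesis by (simp add: norm_bv_set_fun.rep_eq)
qed

text \<open>The inclusion of the probability measures into the finite signed measures.\<close>

definition incl :: "'a measure \<Rightarrow> 'a bv_set_fun" where
  "incl \<xi> = Abs_bv_set_fun (measure \<xi>)"

lemma (in finite_measure) set_fun_incl: "set_fun (incl M) = measure M"
proof -
  have "bounded_variation (measure M)"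
  proof (rule bounded_variationI)
    fix \<A> :: "'a set set" assume \<A>: "finite \<A>" "disjoint \<A>"
    have disj: "disjoint_family_on (\<lambda>A. A) (\<A> \<inter> sets M)"
      using \<A>(2) by (auto simp: disjoint_family_on_def disjoint_def)
    have "(\<Sum>A\<in>\<A>. \<bar>measure M A\<bar>) = (\<Sum>A\<in>\<A> \<inter> sets M. measure M A)"
      using \<A> by (intro sum.mono_neutral_cong_right) (auto simp: measure_notin_sets)
    also have "\<dots> = measure M (\<Union>A\<in>\<A> \<inter> sets M. A)"
      using \<A> disj by (intro finite_measure_finite_Union[symmetric]) auto
    also have "\<dots> \<le> measure M (space M)" by (rule bounded_measure)
    finally show "(\<Sum>A\<in>\<A>. \<bar>measure M A\<bar>) \<le> measure M (space M)" .
  qed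
  then show ?thesis by (simp add: incl_def Abs_bv_set_fun_inverse)
qed

lemma (in finite_measure) incl_in_signed_measures: "incl M \<in> signed_measures M"
  by (auto simp: signed_measures_def countably_additive_on_def set_fun_incl measure_notin_sets
      intro!: finite_measure_UNION)

section \<open>Frechet \<open>C\<^sup>k\<close>-maps on open subsets of coordinate spaces\<close>

text \<open>
  \<open>\<real>\<^sup>n\<close> is \<open>topspace (Euclidean_space n)\<close>, the sequences that vanish from index \<open>n\<close> on.
  The family \<open>d\<close> stands for the linear map \<open>h \<mapsto> (\<Sum>i<n. h i *\<^sub>R d i)\<close>; every linear
  map on \<open>\<real>\<^sup>n\<close> has this form.
\<close>

definition has_frechet_deriv ::
  "nat \<Rightarrow> ((nat \<Rightarrow> real) \<Rightarrow> 'b::real_normed_vector) \<Rightarrow> (nat \<Rightarrow> 'b) \<Rightarrow> (nat \<Rightarrow> real) \<Rightarrow> bool" where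
  "has_frechet_deriv n f d x \<longleftrightarrow>
    ((\<lambda>y. norm (f y - f x - (\<Sum>i<n. (y i - x i) *\<^sub>R d i)) / L2_set (\<lambda>i. y i - x i) {..<n})
      \<longlongrightarrow> 0) (at x within topspace (Euclidean_space n))"

definition frechet_differential ::
  "nat \<Rightarrow> ((nat \<Rightarrow> real) \<Rightarrow> 'b::real_normed_vector) \<Rightarrow> (nat \<Rightarrow> real) \<Rightarrow> (nat \<Rightarrow> real) \<Rightarrow> 'b" where
  "frechet_differential n f x h = (\<Sum>i<n. h i *\<^sub>R (SOME d. has_frechet_deriv n f d x) i)"

text \<open>
  \<open>frechet_C F n j U f\<close>: the map \<open>f : U \<rightarrow> F\<close> on the open set \<open>U \<subseteq> \<real>\<^sup>n\<close> is \<open>j\<close> times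
  continuously Frechet differentiable as a map into the normed subspace \<open>F\<close>. The derivative is a map
  \<open>U \<rightarrow> L(\<real>\<^sup>n, F)\<close>, and \<open>L(\<real>\<^sup>n, F)\<close> is identified with \<open>F\<^sup>n\<close>.
\<close>

primrec frechet_C ::
  "'b::real_normed_vector set \<Rightarrow> nat \<Rightarrow> nat \<Rightarrow> (nat \<Rightarrow> real) set \<Rightarrow> ((nat \<Rightarrow> real) \<Rightarrow> 'b) \<Rightarrow> bool" where
  "frechet_C F n 0 U f \<longleftrightarrow> f ` U \<subseteq> F \<and> continuous_on U f"
| "frechet_C F n (Suc j) U f \<longleftrightarrow> f ` U \<subseteq> F \<and>
    (\<exists>d. (\<forall>x\<in>U. has_frechet_deriv n f (d x) x) \<and> (\<forall>i<n. frechet_C F n j U (\<lambda>x. d x i)))"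

definition Ck_map ::
  "enat \<Rightarrow> 'b::real_normed_vector set \<Rightarrow> nat \<Rightarrow> (nat \<Rightarrow> real) set \<Rightarrow> ((nat \<Rightarrow> real) \<Rightarrow> 'b) \<Rightarrow> bool" where
  "Ck_map k F n U f \<longleftrightarrow> (\<forall>j. enat j \<le> k \<longrightarrow> frechet_C F n j U f)"

section \<open>Diffeologies\<close>

text \<open>A map \<open>p : U \<rightarrow> X\<close> with \<open>U\<close> open in \<open>\<real>\<^sup>n\<close> is the triple \<open>(n, U, p)\<close> with
  \<open>p\<close> extensional on \<open>U\<close>.\<close>

type_synonym 'x plot = "nat \<times> (nat \<Rightarrow> real) set \<times> ((nat \<Rightarrow> real) \<Rightarrow> 'x)"

definition parametrizations :: "'x set \<Rightarrow> 'x plot set" where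
  "parametrizations X = {(n, U, p). openin (Euclidean_space n) U \<and> p \<in> U \<rightarrow>\<^sub>E X}"

definition Ck_diffeology :: "enat \<Rightarrow> 'x set \<Rightarrow> 'x plot set \<Rightarrow> bool" where
  "Ck_diffeology k X \<D> \<longleftrightarrow> X \<noteq> {} \<and> \<D> \<subseteq> parametrizations X \<and>
    (\<forall>n. \<forall>x\<in>X. (n, topspace (Euclidean_space n), \<lambda>r\<in>topspace (Euclidean_space n). x) \<in> \<D>) \<and>
    (\<forall>n U p. (n, U, p) \<in> parametrizations X \<longrightarrow>
      (\<forall>r\<in>U. \<exists>V. openin (Euclidean_space n) V \<and> r \<in> V \<and> V \<subseteq> U \<and> (n, V, restrict p V) \<in> \<D>) \<longrightarrow>
      (n, U, p) \<in> \<D>) \<and>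
    (\<forall>n U p m V \<psi>. (n, U, p) \<in> \<D> \<longrightarrow> openin (Euclidean_space m) V \<longrightarrow>
      \<psi> ` V \<subseteq> U \<longrightarrow> (\<forall>i<n. Ck_map k UNIV m V (\<lambda>r. \<psi> r i)) \<longrightarrow>
      (m, V, \<lambda>r\<in>V. p (\<psi> r)) \<in> \<D>)"

definition Ck_on_interval :: "'x plot set \<Rightarrow> real set \<Rightarrow> (real \<Rightarrow> 'x) \<Rightarrow> bool" where
  "Ck_on_interval \<D> I c \<longleftrightarrow>
    (let U = {r \<in> topspace (Euclidean_space 1). r 0 \<in> I} in (1, U, \<lambda>r\<in>U. c (r 0)) \<in> \<D>)"

section \<open>Diffeological statistical models and the Fisher metric\<close>

text \<open>A measure \<open>M\<close> is used below only for the measurable space \<open>(space M, sets M)\<close>.\<close>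

definition Ck_statistical_model ::
  "enat \<Rightarrow> 'a measure \<Rightarrow> 'a measure set \<Rightarrow> 'a measure plot set \<Rightarrow> bool" where
  "Ck_statistical_model k M P \<D> \<longleftrightarrow> P \<subseteq> space (prob_algebra M) \<and> Ck_diffeology k P \<D> \<and>
    (\<forall>(n, U, p)\<in>\<D>. Ck_map k (signed_measures M) n U (\<lambda>r. incl (p r)))"

definition tangent_cone :: "'a measure plot set \<Rightarrow> 'a measure \<Rightarrow> 'a bv_set_fun set" where
  "tangent_cone \<D> \<xi> = {v. \<exists>\<epsilon>>0. \<exists>c. Ck_on_interval \<D> {-\<epsilon><..<\<epsilon>} c \<and> c 0 = \<xi> \<and>
    ((\<lambda>t. incl (c t)) has_vector_derivative v) (at 0)}"

text \<open>A representative of the Radon--Nikodym derivative \<open>dv/d\<xi> \<in> L\<^sup>1(\<xi>)\<close>.\<close>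

definition log_deriv :: "'a measure \<Rightarrow> 'a bv_set_fun \<Rightarrow> 'a \<Rightarrow> real" where
  "log_deriv \<xi> v = (SOME f. integrable \<xi> f \<and> (\<forall>A\<in>sets \<xi>. (LINT x:A|\<xi>. f x) = set_fun v A))"

definition fisher_metric :: "'a measure \<Rightarrow> 'a bv_set_fun \<Rightarrow> 'a bv_set_fun \<Rightarrow> real" where
  "fisher_metric \<xi> v w = (LINT x|\<xi>. log_deriv \<xi> v x * log_deriv \<xi> w x)"

definition fisher_norm :: "'a measure \<Rightarrow> 'a bv_set_fun \<Rightarrow> real" where
  "fisher_norm \<xi> v = sqrt (fisher_metric \<xi> v v)"

definition almost_2_integrable :: "'a measure set \<Rightarrow> 'a measure plot set \<Rightarrow> bool" where
  "almost_2_integrable P \<D> \<longleftrightarrow> (\<forall>\<xi>\<in>P. \<forall>v\<in>tangent_cone \<D> \<xi>.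
    log_deriv \<xi> v \<in> borel_measurable \<xi> \<and> integrable \<xi> (\<lambda>x. (log_deriv \<xi> v x)\<^sup>2))"

definition two_integrable :: "'a measure set \<Rightarrow> 'a measure plot set \<Rightarrow> bool" where
  "two_integrable P \<D> \<longleftrightarrow> almost_2_integrable P \<D> \<and>
    (\<forall>(n, U, p)\<in>\<D>. continuous_on (U \<times> topspace (Euclidean_space n))
      (\<lambda>(r, h). fisher_norm (p r) (frechet_differential n (\<lambda>s. incl (p s)) r h)))"

section \<open>The Fisher distance\<close>

definition Ck_curve :: "'x plot set \<Rightarrow> real \<Rightarrow> real \<Rightarrow> (real \<Rightarrow> 'x) \<Rightarrow> bool" where
  "Ck_curve \<D> a b c \<longleftrightarrow>
    (\<exists>\<epsilon>>0. \<exists>\<gamma>. Ck_on_interval \<D> {a-\<epsilon><..<b+\<epsilon>} \<gamma> \<and> (\<forall>t\<in>{a..b}. c t = \<gamma> t))"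

definition curve_length :: "real \<Rightarrow> real \<Rightarrow> (real \<Rightarrow> 'a measure) \<Rightarrow> real" where
  "curve_length a b c = integral {a..b}
    (\<lambda>t. fisher_norm (c t) (vector_derivative (\<lambda>s. incl (c s)) (at t within {a..b})))"

text \<open>The breakpoints are \<open>0 = a 0 < a 1 < \<dots> < a m = 1\<close>.\<close>

definition piecewise_Ck_curve ::
  "'a measure plot set \<Rightarrow> nat \<Rightarrow> (nat \<Rightarrow> real) \<Rightarrow> (real \<Rightarrow> 'a measure) \<Rightarrow> bool" where
  "piecewise_Ck_curve \<D> m a c \<longleftrightarrow> continuous_on {0..1} (\<lambda>t. incl (c t)) \<and>
    a 0 = 0 \<and> a m = 1 \<and> (\<forall>j<m. a j < a (Suc j) \<and> Ck_curve \<D> (a j) (a (Suc j)) c)"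

definition fisher_distance :: "'a measure plot set \<Rightarrow> 'a measure \<Rightarrow> 'a measure \<Rightarrow> ereal" where
  "fisher_distance \<D> x y = Inf {ereal (\<Sum>j<m. curve_length (a j) (a (Suc j)) c) | m a c.
    piecewise_Ck_curve \<D> m a c \<and> c 0 = x \<and> c 1 = y}"

end

theory Submission
  imports Defs
begin

text \<open>
  Nonnegativity is immediate, since speeds are nonnegative. Constant curves show that the distance
  from a point to itself is \<open>0\<close>. Symmetry and the triangle inequality hold because piecewise
  curves can be reversed and joined: a diffeology is stable under smooth changes of parameter, and
  the length of a curve is invariant under affine ones (\<open>curve_length_affine\<close>, which rests on
  the homogeneity of the Fisher norm).

  That distinct points have positive distance is seen by comparing probabilities of single events.
  Along a curve \<open>c\<close> with velocity \<open>V\<close> the probability \<open>c t A\<close> has derivative \<open>V t A\<close>,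
  the integral of the density \<open>log V t\<close> over \<open>A\<close>. By the Cauchy--Schwarz inequality in the
  probability space \<open>c t\<close> it is at most the Fisher norm of \<open>V t\<close>. Integration over the curve
  yields \<open>\<bar>y A - x A\<bar> \<le> \<rho>(x, y)\<close> for every event \<open>A\<close>
  (\<open>measure_diff_le_fisher_distance\<close>), so points at distance \<open>0\<close> coincide. Evaluating on one
  event at a time keeps the calculus real-valued.

  Two points need care. The density of \<open>V t\<close> has to exist: nonnegativity of probabilities makes
  \<open>V t\<close> absolutely continuous with respect to \<open>c t\<close>
  (\<open>velocity_absolutely_continuous\<close>), and the Radon--Nikodym theorem for signed measures
  follows from a Jordan decomposition. The speed has to be integrable, since the integral of a
  function that is not integrable is \<open>0\<close> by convention and the lower bound would be lost; this
  is what \<open>2\<close>-integrability provides, through continuity of the speed (\<open>velocity_exists\<close>).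
\<close>

section \<open>Signed measures as set functions\<close>

lemma abs_set_fun_le_norm: "\<bar>set_fun v A\<bar> \<le> norm v"
  using bounded_variation_sum_le[OF set_fun[simplified], of "{A}" v]
  by (simp add: norm_bv_set_fun.rep_eq)

text \<open>
  Evaluation on a fixed event is a bounded linear functional of the signed measure. It turns a
  differentiable curve of measures into a differentiable real function, to which the real mean
  value and integral theorems apply.
\<close>

lemma bounded_linear_set_fun: "bounded_linear (\<lambda>v. set_fun v A)"
  by (rule bounded_linear_intro[where K = 1])
    (simp_all add: plus_bv_set_fun.rep_eq scaleR_bv_set_fun.rep_eq abs_set_fun_le_norm)

lemma uminus_in_signed_measures: "v \<in> signed_measures M \<Longrightarrow> - v \<in> signed_measures M"
  by (auto simp: signed_measures_def countably_additive_on_def uminus_bv_set_fun.rep_eq sums_minus)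

lemma countably_additive_on_empty:
  assumes "countably_additive_on M f"
  shows "f {} = 0"
proof -
  have "(\<lambda>i::nat. f {}) sums f (\<Union>i::nat. {})"
    using assms[unfolded countably_additive_on_def, rule_format, of "\<lambda>_. {}"]
    by (auto simp: disjoint_family_on_def)
  then show ?thesis using summable_const_iff sums_summable by blast
qed

lemma countably_additive_on_Un:
  assumes "countably_additive_on M f" "A \<in> sets M" "B \<in> sets M" "A \<inter> B = {}"
  shows "f (A \<union> B) = f A + f B"
proof -
  have "range (binaryset A B) \<subseteq> sets M" "disjoint_family (binaryset A B)"
    using assms(2-4) by (auto simp: range_binaryset_eq disjoint_family_on_def binaryset_def)
  then have "(\<lambda>i. f (binaryset A B i)) sums f (\<Union>i. binaryset A B i)"
    using assms(1) unfolding countably_additive_on_def by blast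
  then show ?thesis
    using binaryset_sums[of f A B, OF countably_additive_on_empty[OF assms(1)]] sums_unique2
    by (metis UN_binaryset_eq)
qed

section \<open>Jordan decomposition and Radon--Nikodym densities of signed measures\<close>

text \<open>
  This is the positive part of the Jordan decomposition of \<open>f\<close>. Negative values of \<open>f\<close> are
  truncated to \<open>0\<close> by \<open>ennreal\<close>; for countably additive \<open>f\<close> this does not change the
  supremum, since \<open>f {} = 0\<close> competes.
\<close>

definition positive_variation :: "'a measure \<Rightarrow> ('a set \<Rightarrow> real) \<Rightarrow> 'a set \<Rightarrow> ennreal" where
  "positive_variation M f A = (SUP B\<in>{B \<in> sets M. B \<subseteq> A}. ennreal (f B))"

lemma positive_variation_upper: "B \<in> sets M \<Longrightarrow> B \<subseteq> A \<Longrightarrow> ennreal (f B) \<le> positive_variation M f A"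
  unfolding positive_variation_def by (intro SUP_upper) auto

lemma positive_variation_mono: "A \<subseteq> B \<Longrightarrow> positive_variation M f A \<le> positive_variation M f B"
  unfolding positive_variation_def by (intro SUP_subset_mono) auto

lemma positive_variation_superadditive:
  assumes f: "countably_additive_on M f" and "A \<inter> B = {}"
  shows "positive_variation M f A + positive_variation M f B \<le> positive_variation M f (A \<union> B)"
proof -
  let ?S = "\<lambda>A. {B \<in> sets M. B \<subseteq> A}"
  have ne: "?S A \<noteq> {}" for A by (auto intro!: exI[of _ "{}"])
  have "ennreal (f C) + ennreal (f D) \<le> positive_variation M f (A \<union> B)"
    if "C \<in> ?S A" "D \<in> ?S B" for C D
  proof -
    \<comment> \<open>Unless both values are nonnegative, truncation leaves only one summand, and \<open>C\<close> or \<open>D\<close> alone is a competitor.\<close>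
    have CD: "f (C \<union> D) = f C + f D"
      using that assms by (intro countably_additive_on_Un) auto
    have *: "ennreal (f C) \<le> positive_variation M f (A \<union> B)"
      "ennreal (f D) \<le> positive_variation M f (A \<union> B)"
      "ennreal (f (C \<union> D)) \<le> positive_variation M f (A \<union> B)"
      using that by (auto intro!: positive_variation_upper)
    then show ?thesis
      by (cases "0 \<le> f C"; cases "0 \<le> f D") (simp_all add: CD ennreal_neg)
  qed
  then have "(SUP C\<in>?S A. SUP D\<in>?S B. ennreal (f C) + ennreal (f D))
      \<le> positive_variation M f (A \<union> B)"
    by (intro SUP_least)
  then show ?thesis
    unfolding positive_variation_def[of M f A] positive_variation_def[of M f B]
    using ne by (simp only: ennreal_SUP_add_left[symmetric] ennreal_SUP_add_right[symmetric] ne simp_thms)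
qed

text \<open>
  One inequality is finite superadditivity, which passes to the limit by monotonicity. For the
  other one, a competitor \<open>B\<close> for the union is cut into the competitors \<open>B \<inter> A i\<close>, and
  countable additivity of \<open>f\<close> recovers \<open>f B\<close> from the pieces.
\<close>

lemma countably_additive_positive_variation:
  assumes f: "countably_additive_on M f"
  shows "countably_additive (sets M) (positive_variation M f)"
proof (rule countably_additiveI)
  let ?p = "positive_variation M f"
  fix A :: "nat \<Rightarrow> 'a set"
  assume A: "range A \<subseteq> sets M" "disjoint_family A"
  have "(\<Sum>i<n. ?p (A i)) \<le> ?p (\<Union>i<n. A i)" for n
  proof (induction n)
    case (Suc n)
    have "(\<Sum>i<Suc n. ?p (A i)) \<le> ?p (\<Union>i<n. A i) + ?p (A n)"
      unfolding sum.lessThan_Suc using Suc by (rule add_right_mono)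
    also have "\<dots> \<le> ?p ((\<Union>i<n. A i) \<union> A n)"
    proof (rule positive_variation_superadditive[OF f])
      have "A i \<inter> A n = {}" if "i < n" for i
        using A(2) that by (simp add: disjoint_family_on_def)
      then show "(\<Union>i<n. A i) \<inter> A n = {}" by blast
    qed
    finally show ?case by (simp add: lessThan_Suc Un_commute)
  qed (simp)
  then have "(\<Sum>i<n. ?p (A i)) \<le> ?p (\<Union>i. A i)" for n
    by (rule order_trans) (auto intro: positive_variation_mono)
  then have le: "(\<Sum>i. ?p (A i)) \<le> ?p (\<Union>i. A i)"
    by (intro suminf_le_const summableI)
  have "ennreal (f B) \<le> (\<Sum>i. ?p (A i))" if B: "B \<in> sets M" "B \<subseteq> (\<Union>i. A i)" for B
  proof -
    have "range (\<lambda>i. B \<inter> A i) \<subseteq> sets M" "disjoint_family (\<lambda>i. B \<inter> A i)"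
      using A B by (auto simp: disjoint_family_on_def)
    then have "(\<lambda>i. f (B \<inter> A i)) sums f (\<Union>i. B \<inter> A i)"
      using f unfolding countably_additive_on_def by blast
    moreover have "(\<Union>i. B \<inter> A i) = B" using B by auto
    ultimately have "(\<lambda>n. ennreal (\<Sum>i<n. f (B \<inter> A i))) \<longlonglongrightarrow> ennreal (f B)"
      by (intro tendsto_ennrealI) (simp add: sums_def)
    moreover have "ennreal (\<Sum>i<n. f (B \<inter> A i)) \<le> (\<Sum>i. ?p (A i))" for n
    proof -
      have "ennreal (\<Sum>i<n. f (B \<inter> A i)) \<le> ennreal (\<Sum>i<n. max 0 (f (B \<inter> A i)))"
        by (intro ennreal_leI sum_mono) simp
      also have "\<dots> = (\<Sum>i<n. ennreal (max 0 (f (B \<inter> A i))))"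
        by (subst sum_ennreal) auto
      also have "\<dots> \<le> (\<Sum>i<n. ?p (A i))"
      proof (intro sum_mono)
        fix i show "ennreal (max 0 (f (B \<inter> A i))) \<le> ?p (A i)"
          using A B by (simp add: max_def ennreal_neg) (auto intro!: positive_variation_upper)
      qed
      also have "\<dots> \<le> (\<Sum>i. ?p (A i))"
        by (intro sum_le_suminf summableI) auto
      finally show ?thesis .
    qed
    ultimately show ?thesis by (intro LIMSEQ_le_const2) auto
  qed
  then have "?p (\<Union>i. A i) \<le> (\<Sum>i. ?p (A i))"
    unfolding positive_variation_def[of M f "\<Union>i. A i"] by (intro SUP_least) auto
  with le show "(\<Sum>i. ?p (A i)) = ?p (\<Union>i. A i)" by (rule antisym)
qed

text \<open>
  The two inequalities say that \<open>measure N A\<close> is the supremum of \<open>set_fun v B\<close> over the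
  measurable \<open>B \<subseteq> A\<close>. They keep later arguments in the reals.
\<close>

lemma positive_part_measure:
  assumes v: "v \<in> signed_measures M"
  obtains N where "finite_measure N" "sets N = sets M"
    "\<And>A B. A \<in> sets M \<Longrightarrow> B \<in> sets M \<Longrightarrow> B \<subseteq> A \<Longrightarrow> set_fun v B \<le> measure N A"
    "\<And>A c. A \<in> sets M \<Longrightarrow> (\<And>B. B \<in> sets M \<Longrightarrow> B \<subseteq> A \<Longrightarrow> set_fun v B \<le> c) \<Longrightarrow> measure N A \<le> c"
proof
  let ?p = "positive_variation M (set_fun v)"
  let ?N = "measure_of (space M) (sets M) ?p"
  have f: "countably_additive_on M (set_fun v)" using v by (simp add: signed_measures_def)
  note f0 = countably_additive_on_empty[OF f]
  have "positive (sets M) ?p"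
    using f0 by (simp add: positive_def positive_variation_def subset_empty[symmetric] del: subset_empty)
      (auto intro!: antisym SUP_least simp: f0)
  then have emeasure: "emeasure ?N A = ?p A" if "A \<in> sets M" for A
    using that countably_additive_positive_variation[OF f]
    by (intro emeasure_measure_of_sigma) (simp_all add: sets.sigma_algebra_axioms)
  have bound: "?p A \<le> ennreal c" if "\<And>B. B \<in> sets M \<Longrightarrow> B \<subseteq> A \<Longrightarrow> set_fun v B \<le> c" for A c
    unfolding positive_variation_def using that by (intro SUP_least ennreal_leI) auto
  have "set_fun v B \<le> norm v" for B using abs_set_fun_le_norm[of v B] by linarith
  then have "?p (space M) \<le> ennreal (norm v)" by (intro bound)
  then have "?p (space M) \<noteq> \<infinity>" by (auto simp: top_unique)
  then show fin: "finite_measure ?N"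
    by (intro finite_measureI) (simp add: emeasure space_measure_of_conv)
  then interpret finite_measure ?N .
  show "sets ?N = sets M" by simp
  show "set_fun v B \<le> measure ?N A" if "A \<in> sets M" "B \<in> sets M" "B \<subseteq> A" for A B
  proof -
    have "ennreal (set_fun v B) \<le> ennreal (measure ?N A)"
      using positive_variation_upper[OF that(2,3), of "set_fun v"] emeasure[OF that(1)]
      by (simp add: emeasure_eq_measure)
    then show ?thesis by (simp add: ennreal_le_iff)
  qed
  show "measure ?N A \<le> c"
    if A: "A \<in> sets M" and c: "\<And>B. B \<in> sets M \<Longrightarrow> B \<subseteq> A \<Longrightarrow> set_fun v B \<le> c" for A c
  proof -
    have "0 \<le> c" using c[of "{}"] f0 by simp
    moreover have "ennreal (measure ?N A) \<le> ennreal c"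
      using bound[OF c] emeasure[OF A] by (simp add: emeasure_eq_measure)
    ultimately show ?thesis by (simp add: ennreal_le_iff)
  qed
qed

text \<open>
  The measure \<open>N'\<close> is the positive part of \<open>- v\<close>. For \<open>B \<subseteq> A\<close> one has
  \<open>v B = v A - v (A - B)\<close>; taking suprema over \<open>B\<close> gives \<open>N A \<le> v A + N' A\<close>, and the
  same for \<open>- v\<close> gives the opposite inequality. Both parts vanish where \<open>v\<close> vanishes on all
  subsets, so they inherit absolute continuity from \<open>v\<close>.
\<close>

lemma Jordan_decomposition:
  assumes v: "v \<in> signed_measures M"
  obtains N N' where "finite_measure N" "sets N = sets M" "finite_measure N'" "sets N' = sets M"
    "\<And>A. A \<in> sets M \<Longrightarrow> set_fun v A = measure N A - measure N' A"
    "\<And>A. A \<in> sets M \<Longrightarrow> (\<And>B. B \<in> sets M \<Longrightarrow> B \<subseteq> A \<Longrightarrow> set_fun v B = 0)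
      \<Longrightarrow> measure N A = 0 \<and> measure N' A = 0"
proof -
  have f: "countably_additive_on M (set_fun v)" using v by (simp add: signed_measures_def)
  obtain N where N: "finite_measure N" "sets N = sets M"
    "\<And>A B. A \<in> sets M \<Longrightarrow> B \<in> sets M \<Longrightarrow> B \<subseteq> A \<Longrightarrow> set_fun v B \<le> measure N A"
    "\<And>A c. A \<in> sets M \<Longrightarrow> (\<And>B. B \<in> sets M \<Longrightarrow> B \<subseteq> A \<Longrightarrow> set_fun v B \<le> c) \<Longrightarrow> measure N A \<le> c"
    by (rule positive_part_measure[OF v]) blast
  obtain N' where N': "finite_measure N'" "sets N' = sets M"
    "\<And>A B. A \<in> sets M \<Longrightarrow> B \<in> sets M \<Longrightarrow> B \<subseteq> A \<Longrightarrow> - set_fun v B \<le> measure N' A"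
    "\<And>A c. A \<in> sets M \<Longrightarrow> (\<And>B. B \<in> sets M \<Longrightarrow> B \<subseteq> A \<Longrightarrow> - set_fun v B \<le> c) \<Longrightarrow> measure N' A \<le> c"
    by (rule positive_part_measure[OF uminus_in_signed_measures[OF v],
          unfolded uminus_bv_set_fun.rep_eq]) blast
  have split: "set_fun v A = set_fun v B + set_fun v (A - B)"
    if "A \<in> sets M" "B \<in> sets M" "B \<subseteq> A" for A B
    using countably_additive_on_Un[OF f, of B "A - B"] that by (auto simp: Un_absorb1)
  show ?thesis
  proof
    fix A assume A: "A \<in> sets M"
    have "measure N A \<le> set_fun v A + measure N' A"
    proof (rule N(4)[OF A])
      fix B assume "B \<in> sets M" "B \<subseteq> A"
      then show "set_fun v B \<le> set_fun v A + measure N' A"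
        using split[of A B] N'(3)[of A "A - B"] A by auto
    qed
    moreover have "measure N' A \<le> - set_fun v A + measure N A"
    proof (rule N'(4)[OF A])
      fix B assume "B \<in> sets M" "B \<subseteq> A"
      then show "- set_fun v B \<le> - set_fun v A + measure N A"
        using split[of A B] N(3)[of A "A - B"] A by auto
    qed
    ultimately show "set_fun v A = measure N A - measure N' A" by simp
    assume "\<And>B. B \<in> sets M \<Longrightarrow> B \<subseteq> A \<Longrightarrow> set_fun v B = 0"
    then show "measure N A = 0 \<and> measure N' A = 0"
      using N(4)[OF A, of 0] N'(4)[OF A, of 0] by (simp add: measure_le_0_iff)
  qed (use N N' in auto)
qed

definition is_density :: "'a measure \<Rightarrow> 'a bv_set_fun \<Rightarrow> ('a \<Rightarrow> real) \<Rightarrow> bool" where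
  "is_density \<xi> v f \<longleftrightarrow> integrable \<xi> f \<and> (\<forall>A\<in>sets \<xi>. (LINT x:A|\<xi>. f x) = set_fun v A)"

lemma finite_measure_density_exists:
  assumes "finite_measure \<xi>" "finite_measure N" "sets N = sets \<xi>" "absolutely_continuous \<xi> N"
  obtains f :: "'a \<Rightarrow> real" where "integrable \<xi> f"
    "\<And>A. A \<in> sets \<xi> \<Longrightarrow> (LINT x:A|\<xi>. f x) = measure N A"
proof -
  interpret finite_measure \<xi> by fact
  interpret N: finite_measure N by fact
  obtain D where D: "D \<in> borel_measurable \<xi>" "AE x in \<xi>. RN_deriv \<xi> N x = ennreal (D x)" "\<And>x. 0 \<le> D x"
    using real_RN_deriv[OF assms(2,4,3)] by metis
  note [measurable] = D(1)
  have "N = density \<xi> (RN_deriv \<xi> N)"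
    using density_RN_deriv[OF assms(4,3)] by simp
  also have "\<dots> = density \<xi> (\<lambda>x. ennreal (D x))"
    using D(2) by (intro density_cong) auto
  finally have N: "N = density \<xi> (\<lambda>x. ennreal (D x))" .
  show ?thesis
  proof
    have "integrable (density \<xi> (\<lambda>x. ennreal (D x))) (\<lambda>_. 1 :: real)"
      using N by (metis N.integrable_const)
    then show "integrable \<xi> D"
      by (subst (asm) integrable_density) (use D in auto)
    fix A assume A[measurable]: "A \<in> sets \<xi>"
    have "measure N A = (LINT x|density \<xi> (\<lambda>x. ennreal (D x)). indicator A x)"
      using A assms(3) by (simp add: N[symmetric])
    also have "\<dots> = (LINT x:A|\<xi>. D x)"
      unfolding set_lebesgue_integral_def
      using D by (subst integral_density) (auto simp: mult.commute)
    finally show "(LINT x:A|\<xi>. D x) = measure N A" by simp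
  qed
qed

text \<open>
  The Radon--Nikodym theorem for signed measures, from the theorem for measures applied to the two
  parts of the Jordan decomposition. It guarantees that the choice in \<open>log_deriv\<close> picks an
  actual density.
\<close>

lemma signed_measure_density_exists:
  assumes "finite_measure \<xi>" "v \<in> signed_measures \<xi>"
    and null: "\<And>A. A \<in> null_sets \<xi> \<Longrightarrow> set_fun v A = 0"
  shows "\<exists>f. is_density \<xi> v f"
proof -
  obtain N N' where N: "finite_measure N" "sets N = sets \<xi>" "finite_measure N'" "sets N' = sets \<xi>"
    and diff: "\<And>A. A \<in> sets \<xi> \<Longrightarrow> set_fun v A = measure N A - measure N' A"
    and zero: "\<And>A. A \<in> sets \<xi> \<Longrightarrow> (\<And>B. B \<in> sets \<xi> \<Longrightarrow> B \<subseteq> A \<Longrightarrow> set_fun v B = 0)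
      \<Longrightarrow> measure N A = 0 \<and> measure N' A = 0"
    by (rule Jordan_decomposition[OF assms(2)]) blast
  have "measure N A = 0 \<and> measure N' A = 0" if "A \<in> null_sets \<xi>" for A
  proof (rule zero)
    show "A \<in> sets \<xi>" using that by auto
    fix B assume "B \<in> sets \<xi>" "B \<subseteq> A"
    then show "set_fun v B = 0" using null_sets_subset[OF that] by (intro null) blast
  qed
  then have "absolutely_continuous \<xi> N" "absolutely_continuous \<xi> N'"
    unfolding absolutely_continuous_def using N
    by (auto intro!: null_setsI simp: finite_measure.emeasure_eq_measure)
  then obtain f g where fg: "integrable \<xi> f" "integrable \<xi> g"
    "\<And>A. A \<in> sets \<xi> \<Longrightarrow> (LINT x:A|\<xi>. f x) = measure N A"
    "\<And>A. A \<in> sets \<xi> \<Longrightarrow> (LINT x:A|\<xi>. g x) = measure N' A"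
    using finite_measure_density_exists[OF assms(1)] N by metis
  have "(LINT x:A|\<xi>. f x - g x) = set_fun v A" if A: "A \<in> sets \<xi>" for A
    using set_integral_diff(2)[of \<xi> A f g] integrable_mult_indicator[OF A fg(1)]
      integrable_mult_indicator[OF A fg(2)]
    by (simp add: fg(3,4)[OF A] diff[OF A] set_integrable_def)
  then have "is_density \<xi> v (\<lambda>x. f x - g x)"
    using fg by (simp add: is_density_def)
  then show ?thesis by blast
qed

lemma is_density_unique:
  assumes "finite_measure \<xi>" "is_density \<xi> v f" "is_density \<xi> v g"
  shows "AE x in \<xi>. f x = g x"
proof -
  interpret finite_measure \<xi> by fact
  show ?thesis using assms(2,3) by (intro density_unique_banach) (auto simp: is_density_def)
qed

lemma is_density_log_deriv: "(\<exists>f. is_density \<xi> v f) \<Longrightarrow> is_density \<xi> v (log_deriv \<xi> v)"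
  unfolding log_deriv_def is_density_def[symmetric] by (rule someI_ex[of "is_density \<xi> v"])

lemma is_density_scaleR: "is_density \<xi> v f \<Longrightarrow> is_density \<xi> (c *\<^sub>R v) (\<lambda>x. c * f x)"
  by (auto simp: is_density_def scaleR_bv_set_fun.rep_eq)

section \<open>The Fisher norm\<close>

lemma fisher_norm_nonneg: "0 \<le> fisher_norm \<xi> v"
  by (simp add: fisher_norm_def fisher_metric_def)

text \<open>
  Densities are unique almost everywhere, so the norm may be computed with any of them. This gives
  homogeneity, which the chosen representatives \<open>log_deriv\<close> need not satisfy pointwise.
\<close>

lemma fisher_norm_eq:
  assumes "finite_measure \<xi>" "is_density \<xi> v f"
  shows "fisher_norm \<xi> v = sqrt (LINT x|\<xi>. (f x)\<^sup>2)"
proof -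
  have l: "is_density \<xi> v (log_deriv \<xi> v)" using assms(2) by (blast intro: is_density_log_deriv)
  have "AE x in \<xi>. log_deriv \<xi> v x = f x" by (rule is_density_unique[OF assms(1) l assms(2)])
  moreover have "f \<in> borel_measurable \<xi>" "log_deriv \<xi> v \<in> borel_measurable \<xi>"
    using l assms by (auto simp: is_density_def)
  ultimately have "(LINT x|\<xi>. log_deriv \<xi> v x * log_deriv \<xi> v x) = (LINT x|\<xi>. (f x)\<^sup>2)"
    by (intro integral_cong_AE) (auto simp: power2_eq_square)
  then show ?thesis by (simp add: fisher_norm_def fisher_metric_def)
qed

lemma fisher_norm_scaleR:
  assumes "finite_measure \<xi>" "\<exists>f. is_density \<xi> v f"
  shows "fisher_norm \<xi> (c *\<^sub>R v) = \<bar>c\<bar> * fisher_norm \<xi> v"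
proof -
  obtain f where f: "is_density \<xi> v f" using assms(2) ..
  show ?thesis
    unfolding fisher_norm_eq[OF assms(1) f] fisher_norm_eq[OF assms(1) is_density_scaleR[OF f]]
    by (simp add: power_mult_distrib real_sqrt_mult)
qed

lemma fisher_norm_0:
  assumes "finite_measure \<xi>"
  shows "fisher_norm \<xi> 0 = 0"
proof -
  have "is_density \<xi> 0 (\<lambda>_. 0)" by (simp add: is_density_def zero_bv_set_fun.rep_eq)
  from fisher_norm_eq[OF assms this] show ?thesis by simp
qed

text \<open>
  \<open>v A\<close> is the integral of the density over \<open>A\<close>, hence at most its \<open>L\<^sup>1\<close>-norm, and on a
  probability space the \<open>L\<^sup>1\<close>-norm is at most the \<open>L\<^sup>2\<close>-norm. The latter inequality is read
  off from the nonnegativity of a variance.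
\<close>

lemma abs_set_fun_le_fisher_norm:
  assumes "prob_space \<xi>" "\<exists>f. is_density \<xi> v f"
    and square: "integrable \<xi> (\<lambda>x. (log_deriv \<xi> v x)\<^sup>2)" and A: "A \<in> sets \<xi>"
  shows "\<bar>set_fun v A\<bar> \<le> fisher_norm \<xi> v"
proof -
  interpret prob_space \<xi> by fact
  let ?l = "log_deriv \<xi> v"
  have dens: "is_density \<xi> v ?l" by (rule is_density_log_deriv) fact
  then have int: "integrable \<xi> ?l" by (simp add: is_density_def)
  let ?X = "\<lambda>x. \<bar>?l x\<bar>"
  have "0 \<le> variance ?X" by (rule variance_positive)
  also have "\<dots> = expectation (\<lambda>x. (?l x)\<^sup>2) - (expectation ?X)\<^sup>2"
    using variance_eq[of ?X] int square by simp
  finally have "expectation ?X \<le> sqrt (expectation (\<lambda>x. (?l x)\<^sup>2))"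
    by (intro real_le_rsqrt) simp
  then have le: "expectation ?X \<le> fisher_norm \<xi> v" by (simp add: fisher_norm_eq[OF finite_measure_axioms dens])
  have "\<bar>set_fun v A\<bar> = \<bar>LINT x:A|\<xi>. ?l x\<bar>" using dens A by (simp add: is_density_def)
  also have "\<dots> \<le> expectation (\<lambda>x. \<bar>indicator A x * ?l x\<bar>)"
    unfolding set_lebesgue_integral_def by simp
  also have "\<dots> \<le> expectation ?X"
    using int A integrable_mult_indicator[OF A int]
    by (intro integral_mono) (auto simp: indicator_def )
  finally show ?thesis using le by simp
qed

section \<open>Plots on the real line\<close>

text \<open>
  The elements of \<open>\<real>\<^sup>1\<close> are the sequences that vanish from index \<open>1\<close> on; \<open>line\<close>
  is the inverse of the coordinate map \<open>r \<mapsto> r 0\<close>.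
\<close>

definition line :: "real \<Rightarrow> nat \<Rightarrow> real" where
  "line t = (\<lambda>i. if i = 0 then t else 0)"

lemma line_0 [simp]: "line t 0 = t"
  by (simp add: line_def)

lemma line_in_topspace: "line t \<in> topspace (Euclidean_space 1)"
  by (simp add: line_def topspace_Euclidean_space)

lemmas [simp] = line_in_topspace line_in_topspace[simplified]

lemma continuous_on_line: "continuous_on S line"
proof (rule continuous_on_coordinatewise_then_product)
  show "continuous_on S (\<lambda>t. line t i)" for i
    by (cases "i = 0") (simp_all add: line_def)
qed

lemma has_frechet_deriv_line:
  assumes "has_frechet_deriv 1 f d (line t)"
  shows "((\<lambda>s. f (line s)) has_vector_derivative d 0) (at t)"
proof -
  have "filterlim line (at (line t) within topspace (Euclidean_space 1)) (at t)"
    unfolding filterlim_at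
  proof
    show "\<forall>\<^sub>F s in at t. line s \<in> topspace (Euclidean_space 1) \<and> line s \<noteq> line t"
      using eventually_neq_at_within[of t t UNIV]
      by eventually_elim (metis line_0 line_in_topspace)
    show "line \<midarrow>t\<rightarrow> line t"
      using continuous_on_line[of UNIV] by (simp add: continuous_on_eq_continuous_at isContD)
  qed
  from filterlim_compose[OF assms[unfolded has_frechet_deriv_def] this]
  have "((\<lambda>s. norm (f (line s) - f (line t) - (s - t) *\<^sub>R d 0) / norm (s - t)) \<longlongrightarrow> 0) (at t)"
    by (simp add: L2_set_def)
  then show ?thesis
    by (simp add: has_vector_derivative_def has_derivative_iff_norm bounded_linear_scaleR_left)
qed

text \<open>
  A Frechet derivative is determined only in its entries of index below the dimension, so the
  choice made in \<open>frechet_differential\<close> may differ from \<open>d\<close>; the entry of index \<open>0\<close> is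
  fixed by the uniqueness of derivatives of curves.
\<close>

lemma frechet_differential_line:
  assumes "has_frechet_deriv 1 f d (line t)"
  shows "frechet_differential 1 f (line t) (line 1) = d 0"
proof -
  have "has_frechet_deriv 1 f (SOME d. has_frechet_deriv 1 f d (line t)) (line t)"
    using assms by (rule someI[of "\<lambda>d. has_frechet_deriv 1 f d (line t)"])
  from vector_derivative_unique_at[OF has_frechet_deriv_line[OF this] has_frechet_deriv_line[OF assms]]
  show ?thesis by (simp add: frechet_differential_def)
qed

lemma continuous_on_coordinate: "continuous_on S (\<lambda>r :: nat \<Rightarrow> real. r i)"
  by (rule continuous_on_subset[OF continuous_on_product_coordinates]) simp

lemma openin_interval_domain:
  assumes "open I"
  shows "openin (Euclidean_space 1) {r \<in> topspace (Euclidean_space 1). r 0 \<in> I}"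
proof (rule openin_continuous_map_preimage)
  show "continuous_map (Euclidean_space 1) euclideanreal (\<lambda>r. r 0)"
    by (simp add: continuous_map_Euclidean_space_iff continuous_on_coordinate)
qed (use assms in simp)

lemma frechet_C_const: "frechet_C UNIV n j U (\<lambda>_. c)"
proof (induction j arbitrary: c)
  case (Suc j)
  have "has_frechet_deriv n (\<lambda>_. c) (\<lambda>_. 0) x" for x
    by (simp add: has_frechet_deriv_def)
  with Suc show ?case by (auto intro!: exI[of _ "\<lambda>_ _. 0"])
qed simp

lemma Ck_map_affine: "Ck_map k UNIV 1 U (\<lambda>r. \<alpha> * r 0 + \<beta> :: real)"
  unfolding Ck_map_def
proof (intro allI impI)
  fix j
  show "frechet_C UNIV 1 j U (\<lambda>r. \<alpha> * r 0 + \<beta>)"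
  proof (cases j)
    case 0
    then show ?thesis by (auto intro!: continuous_intros continuous_on_coordinate)
  next
    case (Suc i)
    have "has_frechet_deriv 1 (\<lambda>r. \<alpha> * r 0 + \<beta>) (\<lambda>_. \<alpha>) x" for x
      by (simp add: has_frechet_deriv_def algebra_simps)
    then show ?thesis unfolding Suc
      by (auto intro!: exI[of _ "\<lambda>_ _. \<alpha>"] frechet_C_const)
  qed
qed

text \<open>
  Affine maps are smooth, so this is closure of a diffeology under precomposition with smooth
  maps. Translation, reversal, rescaling and restriction of curves are all instances.
\<close>

lemma Ck_on_interval_affine:
  assumes diff: "Ck_diffeology k X \<D>" and c: "Ck_on_interval \<D> I c"
    and J: "open J" "\<And>t. t \<in> J \<Longrightarrow> \<alpha> * t + \<beta> \<in> I"
  shows "Ck_on_interval \<D> J (\<lambda>t. c (\<alpha> * t + \<beta>))"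
proof -
  let ?U = "\<lambda>I. {r \<in> topspace (Euclidean_space 1). r 0 \<in> I}"
  let ?\<psi> = "\<lambda>r. line (\<alpha> * r 0 + \<beta>)"
  have "(1, ?U I, \<lambda>r\<in>?U I. c (r 0)) \<in> \<D>"
    using c by (simp add: Ck_on_interval_def Let_def)
  moreover have "openin (Euclidean_space 1) (?U J)" by (rule openin_interval_domain) fact
  moreover have im: "?\<psi> ` ?U J \<subseteq> ?U I" using J(2) by auto
  moreover have "\<forall>i<1. Ck_map k UNIV 1 (?U J) (\<lambda>r. ?\<psi> r i)" by (simp add: Ck_map_affine[simplified])
  ultimately have "(1, ?U J, \<lambda>r\<in>?U J. (\<lambda>r\<in>?U I. c (r 0)) (?\<psi> r)) \<in> \<D>"
    using diff unfolding Ck_diffeology_def by blast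
  also have "(\<lambda>r\<in>?U J. (\<lambda>r\<in>?U I. c (r 0)) (?\<psi> r)) = (\<lambda>r\<in>?U J. c (\<alpha> * r 0 + \<beta>))"
    using J(2) by (intro restrict_ext) auto
  finally show ?thesis unfolding Ck_on_interval_def Let_def .
qed

lemma Ck_on_interval_const:
  assumes "Ck_diffeology k X \<D>" "x \<in> X" "open J"
  shows "Ck_on_interval \<D> J (\<lambda>_. x)"
proof -
  have "Ck_on_interval \<D> UNIV (\<lambda>_. x)"
    using assms(1,2) by (simp add: Ck_diffeology_def Ck_on_interval_def)
  from Ck_on_interval_affine[OF assms(1) this assms(3)] show ?thesis by simp
qed

section \<open>Velocities of curves in a model\<close>

locale two_integrable_model =
  fixes k :: enat and M :: "'a measure" and P :: "'a measure set" and \<D> :: "'a measure plot set"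
  assumes one_le: "1 \<le> k"
    and model: "Ck_statistical_model k M P \<D>"
    and two_integrable: "two_integrable P \<D>"
begin

lemma diffeology: "Ck_diffeology k P \<D>"
  using model by (simp add: Ck_statistical_model_def)

lemma prob_space_P: "x \<in> P \<Longrightarrow> prob_space x" and sets_P: "x \<in> P \<Longrightarrow> sets x = sets M"
  using model by (auto simp: Ck_statistical_model_def space_prob_algebra)

lemma set_fun_incl_P: "x \<in> P \<Longrightarrow> set_fun (incl x) A = measure x A"
  using finite_measure.set_fun_incl[of x] prob_space_P[of x] by (simp add: prob_space_def)

text \<open>
  Besides being the derivative, the velocity carries all that is used about curves: it has a
  density, so that its Fisher norm is homogeneous; its values on events are dominated by its Fisher
  norm; and its Fisher norm is continuous, so that the length is a convergent integral.
\<close>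

definition velocity_on :: "real set \<Rightarrow> (real \<Rightarrow> 'a measure) \<Rightarrow> (real \<Rightarrow> 'a bv_set_fun) \<Rightarrow> bool" where
  "velocity_on I c V \<longleftrightarrow>
    (\<forall>t\<in>I. c t \<in> P \<and> ((\<lambda>s. incl (c s)) has_vector_derivative V t) (at t within I) \<and>
      (\<exists>f. is_density (c t) (V t) f) \<and>
      (\<forall>A. \<bar>set_fun (V t) A\<bar> \<le> fisher_norm (c t) (V t))) \<and>
    continuous_on I (\<lambda>t. fisher_norm (c t) (V t))"

text \<open>
  If \<open>A\<close> is a null set for \<open>c t\<close>, then the nonnegative function \<open>s \<mapsto> c s A\<close> has a minimum at
  \<open>t\<close>, so its derivative vanishes there.
\<close>

lemma velocity_absolutely_continuous:
  assumes "open I" "t \<in> I" and P: "\<And>s. s \<in> I \<Longrightarrow> c s \<in> P"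
    and v: "((\<lambda>s. incl (c s)) has_vector_derivative v) (at t)" and A: "A \<in> null_sets (c t)"
  shows "set_fun v A = 0"
proof -
  have "((\<lambda>s. set_fun (incl (c s)) A) has_vector_derivative set_fun v A) (at t)"
    using bounded_linear.has_vector_derivative[OF bounded_linear_set_fun v] .
  then have "((\<lambda>s. measure (c s) A) has_real_derivative set_fun v A) (at t)"
    unfolding has_real_derivative_iff_has_vector_derivative
    by (rule has_vector_derivative_transform_within_open[OF _ assms(1,2)])
      (simp add: P set_fun_incl_P)
  moreover have "measure (c t) A = 0" using A by (rule measure_eq_0_null_sets)
  ultimately show ?thesis by (intro DERIV_local_min[where d = 1]) auto
qed

text \<open>
  The derivative takes values in the signed measures because the model maps are \<open>C\<^sup>1\<close> into that
  subspace. Translating \<open>t\<close> to \<open>0\<close> shows that the velocity at \<open>t\<close> belongs to the tangent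
  cone, which gives square integrability of its density. Continuity of its Fisher norm is
  \<open>2\<close>-integrability along the constant vector field \<open>line 1\<close>.
\<close>

lemma velocity_exists:
  assumes c: "Ck_on_interval \<D> I c" and "open I"
  obtains V where "velocity_on I c V"
proof -
  let ?U = "{r \<in> topspace (Euclidean_space 1). r 0 \<in> I}"
  let ?p = "\<lambda>r\<in>?U. c (r 0)"
  let ?f = "\<lambda>r. incl (?p r)"
  have p: "(1, ?U, ?p) \<in> \<D>" using c by (simp add: Ck_on_interval_def Let_def)
  then have "Ck_map k (signed_measures M) 1 ?U ?f"
    using model unfolding Ck_statistical_model_def by blast
  then have "frechet_C (signed_measures M) 1 (Suc 0) ?U ?f"
    using one_le unfolding Ck_map_def one_enat_def One_nat_def by blast
  then obtain d where d: "\<And>r. r \<in> ?U \<Longrightarrow> has_frechet_deriv 1 ?f (d r) r"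
    and d_in: "\<And>r. r \<in> ?U \<Longrightarrow> d r 0 \<in> signed_measures M"
    unfolding frechet_C.simps by (auto simp: image_subset_iff)
  define V where "V t = d (line t) 0" for t
  have U: "line t \<in> ?U" if "t \<in> I" for t using that by simp
  have c_P: "c t \<in> P" if "t \<in> I" for t
  proof -
    have "\<D> \<subseteq> parametrizations P" using diffeology by (simp add: Ck_diffeology_def)
    then have "(1, ?U, ?p) \<in> parametrizations P" using p by (rule subsetD)
    then have "?p \<in> ?U \<rightarrow>\<^sub>E P" unfolding parametrizations_def by (elim CollectE case_prodE) simp
    then have "?p (line t) \<in> P" using U[OF that] by (rule PiE_mem)
    then show ?thesis using U[OF that] by simp
  qed
  have deriv: "((\<lambda>s. incl (c s)) has_vector_derivative V t) (at t)" if "t \<in> I" for t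
    unfolding V_def
    by (rule has_vector_derivative_transform_within_open[OF
          has_frechet_deriv_line[OF d[OF U[OF that]]] \<open>open I\<close> that]) simp
  have density: "\<exists>f. is_density (c t) (V t) f" if "t \<in> I" for t
  proof (rule signed_measure_density_exists)
    show "finite_measure (c t)" using prob_space_P[OF c_P[OF that]] by (simp add: prob_space_def)
    show "V t \<in> signed_measures (c t)"
      using d_in[OF U[OF that]] sets_P[OF c_P[OF that]]
      by (simp add: V_def signed_measures_def countably_additive_on_def)
    show "set_fun (V t) A = 0" if "A \<in> null_sets (c t)" for A
      using velocity_absolutely_continuous[OF \<open>open I\<close> \<open>t \<in> I\<close> c_P deriv[OF \<open>t \<in> I\<close>] that] .
  qed
  have tangent: "V t \<in> tangent_cone \<D> (c t)" if "t \<in> I" for t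
  proof -
    obtain \<epsilon> where \<epsilon>: "\<epsilon> > 0" "ball t \<epsilon> \<subseteq> I" using \<open>open I\<close> \<open>t \<in> I\<close> open_contains_ball by blast
    have "1 * s + t \<in> I" if "s \<in> {-\<epsilon><..<\<epsilon>}" for s
      using that by (intro subsetD[OF \<epsilon>(2)]) (auto simp: dist_real_def)
    then have "Ck_on_interval \<D> {-\<epsilon><..<\<epsilon>} (\<lambda>s. c (1 * s + t))"
      by (intro Ck_on_interval_affine[OF diffeology c]) auto
    moreover have "((\<lambda>s. 1 * s + t) has_vector_derivative 1) (at 0)"
      by (auto intro!: derivative_eq_intros)
    then have "((\<lambda>s. incl (c (1 * s + t))) has_vector_derivative V t) (at 0)"
      using vector_diff_chain_at[of "\<lambda>s. 1 * s + t" 1 0 "\<lambda>s. incl (c s)" "V t"] deriv[OF that]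
      by (simp add: o_def)
    ultimately show ?thesis
      unfolding tangent_cone_def using \<epsilon>(1)
      by (intro CollectI exI[of _ \<epsilon>] conjI exI[of _ "\<lambda>s. c (1 * s + t)"]) auto
  qed
  have bound: "\<bar>set_fun (V t) A\<bar> \<le> fisher_norm (c t) (V t)" if "t \<in> I" for t A
  proof (cases "A \<in> sets M")
    case True
    have "integrable (c t) (\<lambda>x. (log_deriv (c t) (V t) x)\<^sup>2)"
      using two_integrable tangent[OF that] c_P[OF that]
      by (simp add: two_integrable_def almost_2_integrable_def)
    then show ?thesis
      using True sets_P[OF c_P[OF that]]
      by (intro abs_set_fun_le_fisher_norm prob_space_P c_P density that) auto
  next
    case False
    then have "set_fun (V t) A = 0"
      using d_in[OF U[OF that]] by (simp add: V_def signed_measures_def)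
    then show ?thesis by (simp add: fisher_norm_nonneg)
  qed
  have "continuous_on (?U \<times> topspace (Euclidean_space 1))
      (\<lambda>(r, h). fisher_norm (?p r) (frechet_differential 1 ?f r h))"
    using two_integrable p unfolding two_integrable_def by blast
  then have "continuous_on I (\<lambda>t. case (line t, line 1) of
      (r, h) \<Rightarrow> fisher_norm (?p r) (frechet_differential 1 ?f r h))"
    by (rule continuous_on_compose2)
      (use U in \<open>auto intro!: continuous_on_Pair continuous_on_line continuous_on_const\<close>)
  moreover have "(case (line t, line 1) of (r, h) \<Rightarrow> fisher_norm (?p r) (frechet_differential 1 ?f r h))
      = fisher_norm (c t) (V t)" if "t \<in> I" for t
    using frechet_differential_line[OF d[OF U[OF that]]] U[OF that] by (simp add: V_def)
  ultimately have "continuous_on I (\<lambda>t. fisher_norm (c t) (V t))"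
    by (simp cong: continuous_on_cong)
  then have "velocity_on I c V"
    unfolding velocity_on_def using c_P deriv density bound
    by (auto intro: has_vector_derivative_at_within)
  then show ?thesis by (rule that)
qed

lemma velocity_on_subset:
  assumes V: "velocity_on I c V" and J: "J \<subseteq> I" "\<And>t. t \<in> J \<Longrightarrow> c' t = c t"
  shows "velocity_on J c' V"
proof -
  have "((\<lambda>s. incl (c' s)) has_vector_derivative V t) (at t within J)" if "t \<in> J" for t
  proof -
    have "((\<lambda>s. incl (c s)) has_vector_derivative V t) (at t within J)"
      using V that J(1) unfolding velocity_on_def
      by (blast intro: has_vector_derivative_within_subset)
    then show ?thesis
      by (rule has_vector_derivative_transform[OF that, rotated]) (simp add: J)
  qed
  moreover have "continuous_on J (\<lambda>t. fisher_norm (c t) (V t))"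
    using V J(1) continuous_on_subset unfolding velocity_on_def by blast
  then have "continuous_on J (\<lambda>t. fisher_norm (c' t) (V t))"
    using J(2) by (simp cong: continuous_on_cong)
  ultimately show ?thesis using V J unfolding velocity_on_def by (simp add: subset_iff)
qed

lemma Ck_curve_velocity:
  assumes "Ck_curve \<D> a b c"
  obtains V where "velocity_on {a..b} c V"
proof -
  obtain \<epsilon> \<gamma> where \<gamma>: "\<epsilon> > 0" "Ck_on_interval \<D> {a-\<epsilon><..<b+\<epsilon>} \<gamma>" "\<forall>t\<in>{a..b}. c t = \<gamma> t"
    using assms unfolding Ck_curve_def by blast
  obtain V where "velocity_on {a-\<epsilon><..<b+\<epsilon>} \<gamma> V" using velocity_exists[OF \<gamma>(2)] by auto
  then have "velocity_on {a..b} c V"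
    by (rule velocity_on_subset) (use \<gamma>(1,3) in auto)
  then show ?thesis by (rule that)
qed

section \<open>Lengths of curves\<close>

lemma has_integral_curve_length:
  assumes V: "velocity_on {a..b} c V" and "a < b"
  shows "((\<lambda>t. fisher_norm (c t) (V t)) has_integral curve_length a b c) {a..b}"
proof -
  have "vector_derivative (\<lambda>s. incl (c s)) (at t within {a..b}) = V t" if "t \<in> {a..b}" for t
    using vector_derivative_within_cbox[of a b t "\<lambda>s. incl (c s)" "V t"] assms that
    by (simp add: velocity_on_def)
  then have "curve_length a b c = integral {a..b} (\<lambda>t. fisher_norm (c t) (V t))"
    unfolding curve_length_def by (intro integral_cong) simp
  moreover have "(\<lambda>t. fisher_norm (c t) (V t)) integrable_on {a..b}"
    using V by (intro integrable_continuous_real) (simp add: velocity_on_def)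
  ultimately show ?thesis by (simp add: integrable_integral)
qed

text \<open>
  The reason why the distance separates points: the probability of \<open>A\<close> changes along the curve
  at the rate \<open>V t A\<close>, which is at most the speed of the curve.
\<close>

lemma measure_diff_le_curve_length:
  assumes c: "Ck_curve \<D> a b c" and "a < b"
  shows "\<bar>measure (c b) A - measure (c a) A\<bar> \<le> curve_length a b c"
proof -
  obtain V where V: "velocity_on {a..b} c V" by (rule Ck_curve_velocity[OF c])
  have "((\<lambda>s. set_fun (incl (c s)) A) has_vector_derivative set_fun (V t) A) (at t within {a..b})"
    if "t \<in> {a..b}" for t
    using V that bounded_linear.has_vector_derivative[OF bounded_linear_set_fun,
        of "\<lambda>s. incl (c s)" "V t"]
    by (simp add: velocity_on_def)
  then have "((\<lambda>t. set_fun (V t) A) has_integral (set_fun (incl (c b)) A - set_fun (incl (c a)) A)) {a..b}"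
    using \<open>a < b\<close> by (intro fundamental_theorem_of_calculus) auto
  then have I: "((\<lambda>t. set_fun (V t) A) has_integral (measure (c b) A - measure (c a) A)) {a..b}"
    using V \<open>a < b\<close> by (simp add: velocity_on_def set_fun_incl_P)
  note L = has_integral_curve_length[OF V \<open>a < b\<close>]
  have *: "set_fun (V t) A \<le> fisher_norm (c t) (V t)" "- set_fun (V t) A \<le> fisher_norm (c t) (V t)"
    if "t \<in> {a..b}" for t
    using V that unfolding velocity_on_def by (auto simp: abs_le_iff)
  have "measure (c b) A - measure (c a) A \<le> curve_length a b c"
    using has_integral_le[OF I L] * by blast
  moreover have "- (measure (c b) A - measure (c a) A) \<le> curve_length a b c"
    using has_integral_le[OF has_integral_neg[OF I] L] * by blast
  ultimately show ?thesis by linarith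
qed

text \<open>
  The hypothesis on the image covers both orientations of the parameter, and \<open>c'\<close> is
  prescribed only on the new interval, so that it may be a piece of a longer curve.
\<close>

lemma Ck_curve_affine:
  assumes c: "Ck_curve \<D> a b c" and "\<alpha> \<noteq> 0" "a' < b'"
    and im: "(\<lambda>t. \<alpha> * t + \<beta>) ` {a'..b'} = {a..b}"
    and c': "\<And>t. t \<in> {a'..b'} \<Longrightarrow> c' t = c (\<alpha> * t + \<beta>)"
  shows "Ck_curve \<D> a' b' c'"
proof -
  obtain \<epsilon> \<gamma> where \<gamma>: "\<epsilon> > 0" "Ck_on_interval \<D> {a-\<epsilon><..<b+\<epsilon>} \<gamma>" "\<forall>t\<in>{a..b}. c t = \<gamma> t"
    using c unfolding Ck_curve_def by blast
  define \<epsilon>' where "\<epsilon>' = \<epsilon> / \<bar>\<alpha>\<bar>"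
  have in_I: "\<alpha> * t + \<beta> \<in> {a-\<epsilon><..<b+\<epsilon>}" if t: "t \<in> {a'-\<epsilon>'<..<b'+\<epsilon>'}" for t
  proof -
    \<comment> \<open>The point of the closed interval nearest to \<open>t\<close>: the affine map moves the points \<open>t\<close> and \<open>u\<close> less than \<open>\<epsilon>\<close> apart.\<close>
    define u where "u = max a' (min b' t)"
    have "\<bar>t - u\<bar> < \<epsilon>'" "u \<in> {a'..b'}"
      using t \<open>a' < b'\<close> \<gamma>(1) \<open>\<alpha> \<noteq> 0\<close> by (auto simp: u_def \<epsilon>'_def max_def min_def)
    then have "\<bar>\<alpha>\<bar> * \<bar>t - u\<bar> < \<epsilon>" "\<alpha> * u + \<beta> \<in> {a..b}"
      using im \<open>\<alpha> \<noteq> 0\<close> by (auto simp: \<epsilon>'_def field_simps)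
    moreover have "\<bar>\<alpha>\<bar> * \<bar>t - u\<bar> = \<bar>(\<alpha> * t + \<beta>) - (\<alpha> * u + \<beta>)\<bar>"
      by (simp add: abs_mult[symmetric] algebra_simps)
    ultimately show ?thesis by auto
  qed
  have "Ck_on_interval \<D> {a'-\<epsilon>'<..<b'+\<epsilon>'} (\<lambda>t. \<gamma> (\<alpha> * t + \<beta>))"
    by (rule Ck_on_interval_affine[OF diffeology \<gamma>(2)]) (use in_I in auto)
  moreover have "\<forall>t\<in>{a'..b'}. c' t = \<gamma> (\<alpha> * t + \<beta>)"
    using im \<gamma>(3) by (auto simp: c')
  moreover have "\<epsilon>' > 0" using \<gamma>(1) \<open>\<alpha> \<noteq> 0\<close> by (simp add: \<epsilon>'_def)
  ultimately show ?thesis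
    unfolding Ck_curve_def by (intro exI[of _ \<epsilon>'] exI[of _ "\<lambda>t. \<gamma> (\<alpha> * t + \<beta>)"]) auto
qed

text \<open>
  The velocity of the reparametrised curve is multiplied by \<open>\<alpha>\<close>, its norm by \<open>\<bar>\<alpha>\<bar>\<close>
  because the Fisher norm is homogeneous, and the substitution rule contributes \<open>1 / \<bar>\<alpha>\<bar>\<close>.
\<close>

lemma curve_length_affine:
  assumes c: "Ck_curve \<D> a b c" and "\<alpha> \<noteq> 0" "a' < b'"
    and im: "(\<lambda>t. \<alpha> * t + \<beta>) ` {a'..b'} = {a..b}"
    and c': "\<And>t. t \<in> {a'..b'} \<Longrightarrow> c' t = c (\<alpha> * t + \<beta>)"
  shows "curve_length a' b' c' = curve_length a b c"
proof -
  obtain V where V: "velocity_on {a..b} c V" by (rule Ck_curve_velocity[OF c])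
  have "a < b"
    using im \<open>\<alpha> \<noteq> 0\<close> \<open>a' < b'\<close>
    by (auto simp: image_affinity_atLeastAtMost split: if_splits)
  have s: "\<alpha> * t + \<beta> \<in> {a..b}" if "t \<in> {a'..b'}" for t using im that by blast
  have "vector_derivative (\<lambda>s. incl (c' s)) (at t within {a'..b'}) = \<alpha> *\<^sub>R V (\<alpha> * t + \<beta>)"
    if t: "t \<in> {a'..b'}" for t
  proof -
    have "((\<lambda>t. \<alpha> * t + \<beta>) has_vector_derivative \<alpha>) (at t within {a'..b'})"
      by (auto intro!: derivative_eq_intros)
    moreover have "((\<lambda>s. incl (c s)) has_vector_derivative V (\<alpha> * t + \<beta>))
        (at (\<alpha> * t + \<beta>) within (\<lambda>t. \<alpha> * t + \<beta>) ` {a'..b'})"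
      unfolding im using V s[OF t] by (simp add: velocity_on_def)
    ultimately have "((\<lambda>s. incl (c s)) \<circ> (\<lambda>t. \<alpha> * t + \<beta>) has_vector_derivative \<alpha> *\<^sub>R V (\<alpha> * t + \<beta>))
        (at t within {a'..b'})"
      by (rule vector_diff_chain_within)
    then have "((\<lambda>s. incl (c' s)) has_vector_derivative \<alpha> *\<^sub>R V (\<alpha> * t + \<beta>)) (at t within {a'..b'})"
      by (rule has_vector_derivative_transform[OF t, rotated]) (simp add: c')
    then show ?thesis
      using vector_derivative_within_cbox[of a' b' t "\<lambda>s. incl (c' s)"] \<open>a' < b'\<close> t by simp
  qed
  moreover have "fisher_norm (c (\<alpha> * t + \<beta>)) (\<alpha> *\<^sub>R V (\<alpha> * t + \<beta>))
      = \<bar>\<alpha>\<bar> * fisher_norm (c (\<alpha> * t + \<beta>)) (V (\<alpha> * t + \<beta>))" if "t \<in> {a'..b'}" for t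
    using V s[OF that] prob_space_P[of "c (\<alpha> * t + \<beta>)"]
    by (intro fisher_norm_scaleR) (auto simp: velocity_on_def prob_space_def)
  ultimately have "curve_length a' b' c'
      = integral {a'..b'} (\<lambda>t. \<bar>\<alpha>\<bar> * fisher_norm (c (\<alpha> * t + \<beta>)) (V (\<alpha> * t + \<beta>)))"
    unfolding curve_length_def by (intro integral_cong) (simp add: c')
  also have "\<dots> = curve_length a b c"
  proof (rule integral_unique)
    have "((\<lambda>t. fisher_norm (c (\<alpha> * t + \<beta>)) (V (\<alpha> * t + \<beta>))) has_integral
        (1 / \<bar>\<alpha>\<bar>) * curve_length a b c) ((\<lambda>t. (1 / \<alpha>) * t + - ((1 / \<alpha>) * \<beta>)) ` {a..b})"
      using has_integral_affinity[of "\<lambda>t. fisher_norm (c t) (V t)" _ a b \<alpha> \<beta>]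
        has_integral_curve_length[OF V \<open>a < b\<close>] \<open>\<alpha> \<noteq> 0\<close>
      by simp
    also have "(\<lambda>t. (1 / \<alpha>) * t + - ((1 / \<alpha>) * \<beta>)) ` {a..b} = {a'..b'}"
      using \<open>\<alpha> \<noteq> 0\<close> by (simp add: im[symmetric] image_image field_simps)
    finally have "((\<lambda>t. \<bar>\<alpha>\<bar> * fisher_norm (c (\<alpha> * t + \<beta>)) (V (\<alpha> * t + \<beta>))) has_integral
        \<bar>\<alpha>\<bar> * ((1 / \<bar>\<alpha>\<bar>) * curve_length a b c)) {a'..b'}"
      by (rule has_integral_mult_right)
    then show "((\<lambda>t. \<bar>\<alpha>\<bar> * fisher_norm (c (\<alpha> * t + \<beta>)) (V (\<alpha> * t + \<beta>))) has_integral
        curve_length a b c) {a'..b'}"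
      using \<open>\<alpha> \<noteq> 0\<close> by simp
  qed
  finally show ?thesis .
qed

end

section \<open>Piecewise curves and the Fisher distance\<close>

lemma curve_length_nonneg: "0 \<le> curve_length a b c"
proof (cases "(\<lambda>t. fisher_norm (c t) (vector_derivative (\<lambda>s. incl (c s)) (at t within {a..b})))
    integrable_on {a..b}")
  case True
  then show ?thesis
    unfolding curve_length_def by (intro integral_nonneg) (auto intro: fisher_norm_nonneg)
next
  case False
  then show ?thesis unfolding curve_length_def by (simp add: not_integrable_integral)
qed

lemma breakpoints_mono:
  assumes "piecewise_Ck_curve \<D> m a c" "i \<le> j" "j \<le> m"
  shows "a i \<le> a j"
  using assms(2,3)
proof (induction j rule: dec_induct)
  case (step n)
  moreover have "a n < a (Suc n)"
    using assms(1) step.prems unfolding piecewise_Ck_curve_def by simp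
  ultimately show ?case by simp
qed simp

lemma breakpoints_in_unit_interval:
  assumes "piecewise_Ck_curve \<D> m a c" "j < m"
  shows "0 \<le> a j" "a j < a (Suc j)" "a (Suc j) \<le> 1"
  using breakpoints_mono[OF assms(1), of 0 j] breakpoints_mono[OF assms(1), of "Suc j" m] assms
  by (auto simp: piecewise_Ck_curve_def)

definition path_length :: "nat \<Rightarrow> (nat \<Rightarrow> real) \<Rightarrow> (real \<Rightarrow> 'a measure) \<Rightarrow> real" where
  "path_length m a c = (\<Sum>j<m. curve_length (a j) (a (Suc j)) c)"

lemma path_length_nonneg: "0 \<le> path_length m a c"
  by (simp add: path_length_def sum_nonneg curve_length_nonneg)

lemma fisher_distance_le:
  assumes "piecewise_Ck_curve \<D> m a c"
  shows "fisher_distance \<D> (c 0) (c 1) \<le> ereal (path_length m a c)"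
  unfolding fisher_distance_def path_length_def using assms by (intro Inf_lower) blast

lemma le_fisher_distance:
  assumes "\<And>m a c. piecewise_Ck_curve \<D> m a c \<Longrightarrow> c 0 = x \<Longrightarrow> c 1 = y \<Longrightarrow> e \<le> ereal (path_length m a c)"
  shows "e \<le> fisher_distance \<D> x y"
  unfolding fisher_distance_def using assms[unfolded path_length_def] by (intro Inf_greatest) blast

lemma fisher_distance_nonneg: "0 \<le> fisher_distance \<D> x y"
  by (rule le_fisher_distance) (simp add: path_length_nonneg)

lemma sum_lessThan_add:
  fixes f :: "nat \<Rightarrow> real"
  shows "(\<Sum>i<m + n. f i) = (\<Sum>i<m. f i) + (\<Sum>i<n. f (m + i))"
  by (induction n) (simp_all add: add.assoc)

context two_integrable_model
begin

lemma measure_diff_le_path_length: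
  assumes c: "piecewise_Ck_curve \<D> m a c"
  shows "\<bar>measure (c 1) A - measure (c 0) A\<bar> \<le> path_length m a c"
proof -
  have "measure (c 1) A - measure (c 0) A = (\<Sum>j<m. measure (c (a (Suc j))) A - measure (c (a j)) A)"
    using c by (subst sum_lessThan_telescope) (simp add: piecewise_Ck_curve_def)
  also have "\<bar>\<dots>\<bar> \<le> (\<Sum>j<m. \<bar>measure (c (a (Suc j))) A - measure (c (a j)) A\<bar>)"
    by (rule sum_abs)
  also have "\<dots> \<le> path_length m a c"
    unfolding path_length_def using c
    by (intro sum_mono measure_diff_le_curve_length) (auto simp: piecewise_Ck_curve_def)
  finally show ?thesis .
qed

lemma measure_diff_le_fisher_distance:
  "ereal \<bar>measure y A - measure x A\<bar> \<le> fisher_distance \<D> x y"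
  using measure_diff_le_path_length by (intro le_fisher_distance) auto

lemma fisher_distance_eq_0_imp_eq:
  assumes "x \<in> P" "y \<in> P" "fisher_distance \<D> x y = 0"
  shows "x = y"
proof (rule measure_eqI)
  show "sets x = sets y" using assms by (simp add: sets_P)
  interpret x: prob_space x by (rule prob_space_P) fact
  interpret y: prob_space y by (rule prob_space_P) fact
  show "emeasure x A = emeasure y A" for A
    using measure_diff_le_fisher_distance[of y A x] assms(3)
    by (simp add: x.emeasure_eq_measure y.emeasure_eq_measure)
qed

lemma fisher_distance_self:
  assumes "x \<in> P"
  shows "fisher_distance \<D> x x = 0"
proof (rule antisym[OF _ fisher_distance_nonneg])
  let ?a = "\<lambda>j :: nat. real j"
  have "Ck_on_interval \<D> {0 - 1<..<1 + 1} (\<lambda>_. x)"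
    by (rule Ck_on_interval_const[OF diffeology assms]) simp
  then have "Ck_curve \<D> 0 1 (\<lambda>_. x)"
    unfolding Ck_curve_def by (intro exI[of _ "1::real"] exI[of _ "\<lambda>_. x"]) auto
  then have "piecewise_Ck_curve \<D> 1 ?a (\<lambda>_. x)"
    by (simp add: piecewise_Ck_curve_def)
  then have "fisher_distance \<D> x x \<le> ereal (path_length 1 ?a (\<lambda>_. x))"
    by (rule fisher_distance_le)
  also have "path_length 1 ?a (\<lambda>_. x) = 0"
  proof -
    have *: "vector_derivative (\<lambda>_. incl x) (at t within {0..1}) = 0" if "t \<in> {0..1}" for t :: real
      using vector_derivative_within_cbox[of 0 1 t "\<lambda>_. incl x" 0] that by simp
    have "curve_length 0 1 (\<lambda>_. x) = integral {0..1} (\<lambda>_ :: real. 0)"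
      unfolding curve_length_def
      by (intro integral_cong)
        (use * fisher_norm_0[of x] prob_space_P[OF assms] in \<open>simp add: prob_space_def\<close>)
    then show ?thesis by (simp add: path_length_def)
  qed
  finally show "fisher_distance \<D> x x \<le> 0" by (simp add: zero_ereal_def)
qed

text \<open>
  The pieces of the reversed curve are the reversals of the pieces in the opposite order.
\<close>

lemma reverse_path:
  assumes c: "piecewise_Ck_curve \<D> m a c"
  defines "a' \<equiv> \<lambda>j. 1 - a (m - j)" and "c' \<equiv> \<lambda>t. c (1 - t)"
  shows "piecewise_Ck_curve \<D> m a' c'" and "path_length m a' c' = path_length m a c"
proof -
  have piece: "a' j < a' (Suc j)"
    "Ck_curve \<D> (a' j) (a' (Suc j)) c'"
    "curve_length (a' j) (a' (Suc j)) c' = curve_length (a (m - Suc j)) (a (Suc (m - Suc j))) c"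
    if "j < m" for j
  proof -
    define i where "i = m - Suc j"
    have i: "i < m" "m - j = Suc i" "m - Suc j = i" using that by (auto simp: i_def)
    have a': "a' j = 1 - a (Suc i)" "a' (Suc j) = 1 - a i" using i by (simp_all add: a'_def)
    have curve: "Ck_curve \<D> (a i) (a (Suc i)) c" using c i(1) by (simp add: piecewise_Ck_curve_def)
    show less: "a' j < a' (Suc j)"
      using breakpoints_in_unit_interval(2)[OF c i(1)] by (simp add: a')
    have im: "(\<lambda>t. (-1) * t + 1) ` {a' j..a' (Suc j)} = {a i..a (Suc i)}"
      using breakpoints_in_unit_interval(2)[OF c i(1)]
      by (subst image_affinity_atLeastAtMost) (simp add: a')
    show "Ck_curve \<D> (a' j) (a' (Suc j)) c'"
      by (rule Ck_curve_affine[OF curve _ less im]) (simp_all add: c'_def)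
    show "curve_length (a' j) (a' (Suc j)) c' = curve_length (a (m - Suc j)) (a (Suc (m - Suc j))) c"
      unfolding i(3) by (rule curve_length_affine[OF curve _ less im]) (simp_all add: c'_def)
  qed
  have "continuous_on {0..1} (\<lambda>t. incl (c t))" using c by (simp add: piecewise_Ck_curve_def)
  then have "continuous_on {0..1} (\<lambda>t. incl (c' t))"
    unfolding c'_def by (rule continuous_on_compose2) (auto intro!: continuous_intros)
  then show "piecewise_Ck_curve \<D> m a' c'"
    using piece c by (simp add: piecewise_Ck_curve_def a'_def)
  have "path_length m a' c' = (\<Sum>j<m. curve_length (a (m - Suc j)) (a (Suc (m - Suc j))) c)"
    unfolding path_length_def by (intro sum.cong) (simp_all add: piece)
  also have "\<dots> = path_length m a c"
    unfolding path_length_def by (rule sum.nat_diff_reindex)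
  finally show "path_length m a' c' = path_length m a c" .
qed

lemma fisher_distance_commute_le: "fisher_distance \<D> y x \<le> fisher_distance \<D> x y"
proof (rule le_fisher_distance)
  fix m a c assume c: "piecewise_Ck_curve \<D> m a c" "c 0 = x" "c 1 = y"
  show "fisher_distance \<D> y x \<le> ereal (path_length m a c)"
    using fisher_distance_le[OF reverse_path(1)[OF c(1)]] reverse_path(2)[OF c(1)] c(2,3) by simp
qed

text \<open>
  The first curve is run at double speed on \<open>{0..1/2}\<close> and the second on \<open>{1/2..1}\<close>. At the
  common parameter \<open>1/2\<close> both formulas for \<open>g\<close> agree, so \<open>g\<close> is an affine
  reparametrisation of \<open>c\<close> or \<open>e\<close> on every closed piece, ends included.
\<close>

lemma join_paths:
  assumes c: "piecewise_Ck_curve \<D> m a c" and e: "piecewise_Ck_curve \<D> n b e" and "c 1 = e 0"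
  defines "h \<equiv> \<lambda>j. if j \<le> m then a j / 2 else (1 + b (j - m)) / 2"
    and "g \<equiv> \<lambda>t. if t \<le> 1 / 2 then c (2 * t) else e (2 * t - 1)"
  shows "piecewise_Ck_curve \<D> (m + n) h g"
    and "path_length (m + n) h g = path_length m a c + path_length n b e"
proof -
  have h_add: "h (m + j) = (1 + b j) / 2" for j
    using c e by (cases j) (auto simp: h_def piecewise_Ck_curve_def)
  have g_c: "g t = c (2 * t + 0)" if "t \<le> 1 / 2" for t using that by (simp add: g_def)
  have g_e: "g t = e (2 * t + (-1))" if "1 / 2 \<le> t" for t
  proof (cases "t = 1 / 2")
    case True
    then show ?thesis using \<open>c 1 = e 0\<close> by (simp add: g_def True)
  qed (use that in \<open>simp add: g_def\<close>)
  have first: "h j < h (Suc j) \<and> Ck_curve \<D> (h j) (h (Suc j)) g \<and>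
      curve_length (h j) (h (Suc j)) g = curve_length (a j) (a (Suc j)) c" if "j < m" for j
  proof -
    note a = breakpoints_in_unit_interval[OF c that]
    have h: "h j = a j / 2" "h (Suc j) = a (Suc j) / 2" using that by (simp_all add: h_def)
    have "Ck_curve \<D> (a j) (a (Suc j)) c" using c that by (simp add: piecewise_Ck_curve_def)
    moreover have "h j < h (Suc j)" using a by (simp add: h)
    moreover have "(\<lambda>t. 2 * t + 0) ` {h j..h (Suc j)} = {a j..a (Suc j)}"
      using a by (subst image_affinity_atLeastAtMost) (simp add: h)
    moreover have "g t = c (2 * t + 0)" if "t \<in> {h j..h (Suc j)}" for t
      using that a by (intro g_c) (simp add: h)
    ultimately show ?thesis
      using Ck_curve_affine[of "a j" "a (Suc j)" c 2 "h j" "h (Suc j)" 0 g]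
        curve_length_affine[of "a j" "a (Suc j)" c 2 "h j" "h (Suc j)" 0 g]
      by simp
  qed
  have second: "h (m + j) < h (Suc (m + j)) \<and> Ck_curve \<D> (h (m + j)) (h (Suc (m + j))) g \<and>
      curve_length (h (m + j)) (h (Suc (m + j))) g = curve_length (b j) (b (Suc j)) e"
    if "j < n" for j
  proof -
    note b = breakpoints_in_unit_interval[OF e that]
    have h: "h (m + j) = (1 + b j) / 2" "h (Suc (m + j)) = (1 + b (Suc j)) / 2"
      using h_add[of j] h_add[of "Suc j"] by simp_all
    have "Ck_curve \<D> (b j) (b (Suc j)) e" using e that by (simp add: piecewise_Ck_curve_def)
    moreover have "h (m + j) < h (Suc (m + j))" using b by (simp add: h)
    moreover have "(\<lambda>t. 2 * t + (-1)) ` {h (m + j)..h (Suc (m + j))} = {b j..b (Suc j)}"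
      using b by (subst image_affinity_atLeastAtMost) (simp add: h, simp add: field_simps)
    moreover have "g t = e (2 * t + (-1))" if "t \<in> {h (m + j)..h (Suc (m + j))}" for t
      using that b by (intro g_e) (simp add: h)
    ultimately show ?thesis
      using Ck_curve_affine[of "b j" "b (Suc j)" e 2 "h (m + j)" "h (Suc (m + j))" "-1" g]
        curve_length_affine[of "b j" "b (Suc j)" e 2 "h (m + j)" "h (Suc (m + j))" "-1" g]
      by simp
  qed
  have pieces: "h j < h (Suc j) \<and> Ck_curve \<D> (h j) (h (Suc j)) g" if "j < m + n" for j
  proof (cases "j < m")
    case False
    then show ?thesis using second[of "j - m"] that by simp
  qed (use first in blast)
  have "continuous_on ({0..1/2} \<union> {1/2..1}) (\<lambda>t. incl (g t))"
  proof (rule continuous_on_closed_Un)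
    have "continuous_on {0..1/2} (\<lambda>t. incl (c (2 * t)))"
      by (rule continuous_on_compose2[of "{0..1}" "\<lambda>t. incl (c t)"])
        (use c in \<open>auto intro!: continuous_intros simp: piecewise_Ck_curve_def\<close>)
    then show "continuous_on {0..1/2} (\<lambda>t. incl (g t))"
      by (rule continuous_on_eq) (simp add: g_c)
    have "continuous_on {1/2..1} (\<lambda>t. incl (e (2 * t + (-1))))"
      by (rule continuous_on_compose2[of "{0..1}" "\<lambda>t. incl (e t)"])
        (use e in \<open>auto intro!: continuous_intros simp: piecewise_Ck_curve_def\<close>)
    then show "continuous_on {1/2..1} (\<lambda>t. incl (g t))"
      by (rule continuous_on_eq) (simp add: g_e)
  qed auto
  moreover have "{0..1/2} \<union> {1/2..1} = {0..1 :: real}" by auto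
  moreover have "h 0 = 0" "h (m + n) = 1"
    using c e h_add[of n] by (simp_all add: h_def piecewise_Ck_curve_def)
  ultimately show "piecewise_Ck_curve \<D> (m + n) h g"
    using pieces by (simp add: piecewise_Ck_curve_def)
  show "path_length (m + n) h g = path_length m a c + path_length n b e"
    unfolding path_length_def sum_lessThan_add using first second by simp
qed

text \<open>
  Joining curves bounds the distance by the sum of two lengths; the infimum is then taken over one
  curve at a time. The second infimum requires subtracting \<open>fisher_distance \<D> y z\<close>, which is
  legitimate when that is finite.
\<close>

lemma fisher_distance_triangle:
  "fisher_distance \<D> x z \<le> fisher_distance \<D> x y + fisher_distance \<D> y z"
proof -
  have path: "fisher_distance \<D> x z \<le> ereal (path_length m a c) + fisher_distance \<D> y z"
    if c: "piecewise_Ck_curve \<D> m a c" "c 0 = x" "c 1 = y" for m a c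
  proof -
    have "fisher_distance \<D> x z - ereal (path_length m a c) \<le> fisher_distance \<D> y z"
    proof (rule le_fisher_distance)
      fix n b e assume e: "piecewise_Ck_curve \<D> n b e" "e 0 = y" "e 1 = z"
      have "c 1 = e 0" using c e by simp
      from fisher_distance_le[OF join_paths(1)[OF c(1) e(1) this]] join_paths(2)[OF c(1) e(1) this]
      have "fisher_distance \<D> x z \<le> ereal (path_length m a c + path_length n b e)"
        using c e by simp
      then show "fisher_distance \<D> x z - ereal (path_length m a c) \<le> ereal (path_length n b e)"
        by (simp add: ereal_minus_le add.commute)
    qed
    then show ?thesis by (simp add: ereal_minus_le add.commute)
  qed
  show ?thesis
  proof (cases "fisher_distance \<D> y z")
    case (real r)
    have "fisher_distance \<D> x z - ereal r \<le> fisher_distance \<D> x y"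
      by (rule le_fisher_distance) (use path in \<open>simp add: ereal_minus_le real\<close>)
    then show ?thesis by (simp add: ereal_minus_le real)
  next
    case MInf
    then show ?thesis using fisher_distance_nonneg[of \<D> y z] by simp
  qed simp
qed

end

theorem theorem2p15:
  fixes M :: "'a measure" and P :: "'a measure set" and \<D> :: "'a measure plot set" and k :: enat
  assumes "1 \<le> k"
    and "Ck_statistical_model k M P \<D>"
    and "two_integrable P \<D>"
  shows "(\<forall>x\<in>P. \<forall>y\<in>P. 0 \<le> fisher_distance \<D> x y) \<and>
    (\<forall>x\<in>P. \<forall>y\<in>P. fisher_distance \<D> x y = 0 \<longleftrightarrow> x = y) \<and>
    (\<forall>x\<in>P. \<forall>y\<in>P. fisher_distance \<D> x y = fisher_distance \<D> y x) \<and>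
    (\<forall>x\<in>P. \<forall>y\<in>P. \<forall>z\<in>P. fisher_distance \<D> x z \<le> fisher_distance \<D> x y + fisher_distance \<D> y z)"
proof -
  interpret two_integrable_model k M P \<D>
    using assms by unfold_locales
  show ?thesis
    using fisher_distance_nonneg fisher_distance_self fisher_distance_eq_0_imp_eq
      antisym[OF fisher_distance_commute_le fisher_distance_commute_le] fisher_distance_triangle
    by blast
qed

end
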